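(* Let $P$ be a connected projection (diagram) of a link $K$, let $\mathbb{D}:=\mathbb{D}(A)$ be the dessin of $P$ associated to the all-$A$ splicing, and suppose $\mathbb{D}$ has genus $g(\mathbb{D})$. For $j\ge 0$ let $s(j,\mathbb{D})$ be the number of spanning $j$-quasi-trees of $\mathbb{D}$. Then $$\det(K)=\left|\sum_{j=0}^{g(\mathbb{D})}(-1)^j\, s(j,\mathbb{D})\right|.$$
   Context: The determinant $\det(K)$ of a link $K$ is the absolute value of its Jones polynomial (equivalently, of its Alexander polynomial) at $-1$; it is the order of the first homology of the double branched cover (read as $0$ if infinite). A dessin (d'enfant; combinatorial map, oriented ribbon graph) is a finite multigraph (loops and multiple edges allowed) with a cyclic order on the edge-ends at each vertex; equivalently a graph embedded in an orientable surface so that all complementary regions (faces) are disks. For a dessin $\mathbb{D}$, let $v,e,f,k$ denote the numbers of vertices, edges, faces and connected components; faces are counted as boundary components of the associated ribbon surface (an isolated vertex has one face). The genus is $g(\mathbb{D})=\frac{2k(\mathbb{D})-v(\mathbb{D})+e(\mathbb{D})-f(\mathbb{D})}{2}$. A spanning sub-dessin $\mathbb{H}\subset\mathbb{D}$ is obtained by deleting edges (keeping all vertices), with induced cyclic orders; $f(\mathbb{H}),k(\mathbb{H}),g(\mathbb{H})$ are computed for $\mathbb{H}$ as a dessin in its own right. All-$A$ dessin $\mathbb{D}(A)$ of a link diagram $P$: at each crossing the $A$-splicing is the smoothing that joins the two regions swept out when the over-strand is rotated counterclockwise onto the under-strand (the $B$-splicing is the other smoothing). Splice every crossing by its $A$-splicing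 to get disjoint circles in the plane, together with one arc per crossing recording the splice. Vertices of $\mathbb{D}(A)$ are the circles, edges are the crossings (arcs). Orient each circle clockwise or anti-clockwise according to whether it lies inside an odd or even number of the circles; the cyclic order at a vertex is the order in which arc-ends are met along the oriented circle. A spanning quasi-tree of genus $j$ (spanning $j$-quasi-tree) of a connected dessin $\mathbb{D}$ is a connected spanning sub-dessin $\mathbb{H}$ with $g(\mathbb{H})=j$, $f(\mathbb{H})=1$ and $e(\mathbb{H})=v(\mathbb{H})-1+2j$ (any two of these three conditions imply the third). Spanning $0$-quasi-trees are spanning trees. *)

theory Defs
  imports
    "HOL-Analysis.Analysis"
    "HOL-Library.Poly_Mapping"
    "HOL-Combinatorics.Orbits"
begin

section \<open>Dessins\<close>

text \<open>
  A finite multigraph is given by its vertices and its edge-ends: \<open>vert\<close> attaches an edge-end to a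
  vertex, \<open>opp\<close> sends it to the other end of its edge, and \<open>nxt\<close> is the cyclic successor at its
  vertex. Vertices without edge-ends are allowed. The functions are unspecified outside \<open>ends\<close>.
\<close>

record ('v, 'e) dessin =
  verts :: "'v set"
  ends :: "'e set"
  vert :: "'e \<Rightarrow> 'v"
  opp :: "'e \<Rightarrow> 'e"
  nxt :: "'e \<Rightarrow> 'e"

definition is_dessin :: "('v, 'e) dessin \<Rightarrow> bool" where
  "is_dessin D \<longleftrightarrow>
     finite (verts D) \<and> finite (ends D) \<and> vert D ` ends D \<subseteq> verts D \<and>
     (\<forall>d\<in>ends D. opp D d \<in> ends D \<and> opp D d \<noteq> d \<and> opp D (opp D d) = d) \<and>
     (\<forall>v\<in>vert D ` ends D. cyclic_on (nxt D) {d \<in> ends D. vert D d = v})"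

definition edges :: "('v, 'e) dessin \<Rightarrow> 'e set set" where
  "edges D = (\<lambda>d. {d, opp D d}) ` ends D"

text \<open>
  If \<open>nxt\<close> is read counterclockwise, \<open>face D d\<close> is the boundary component of the ribbon surface
  running along the right-hand side of the edge of \<open>d\<close>, walked away from \<open>vert D d\<close>; it is represented
  by all edge-ends from which an edge is walked along it. The left-hand side is \<open>face D (opp D d)\<close>.
\<close>

definition face :: "('v, 'e) dessin \<Rightarrow> 'e \<Rightarrow> 'e set" where
  "face D d = orbit (nxt D \<circ> opp D) d"

definition num_faces :: "('v, 'e) dessin \<Rightarrow> nat" where
  "num_faces D = card (face D ` ends D) + card (verts D - vert D ` ends D)"

definition adjacent :: "('v, 'e) dessin \<Rightarrow> ('v \<times> 'v) set" where
  "adjacent D = {(vert D d, vert D (opp D d)) | d. d \<in> ends D}"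

definition num_components :: "('v, 'e) dessin \<Rightarrow> nat" where
  "num_components D = card ((\<lambda>v. (adjacent D)\<^sup>* `` {v}) ` verts D)"

definition genus :: "('v, 'e) dessin \<Rightarrow> rat" where
  "genus D = (2 * of_nat (num_components D) - of_nat (card (verts D))
                + of_nat (card (edges D)) - of_nat (num_faces D)) / 2"

text \<open>
  The spanning sub-dessin with edge set \<open>F\<close>; its cyclic orders are the first-return maps of \<open>nxt\<close>.
\<close>

definition spanning_sub :: "('v, 'e) dessin \<Rightarrow> 'e set set \<Rightarrow> ('v, 'e) dessin" where
  "spanning_sub D F = D\<lparr>ends := \<Union>F,
     nxt := \<lambda>d. (nxt D ^^ (LEAST n. 0 < n \<and> (nxt D ^^ n) d \<in> \<Union>F)) d\<rparr>"

definition quasi_tree :: "nat \<Rightarrow> ('v, 'e) dessin \<Rightarrow> bool" where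
  "quasi_tree j H \<longleftrightarrow> num_components H = 1 \<and> genus H = of_nat j \<and> num_faces H = 1 \<and>
     int (card (edges H)) = int (card (verts H)) - 1 + 2 * int j"

definition num_quasi_trees :: "nat \<Rightarrow> ('v, 'e) dessin \<Rightarrow> nat" where
  "num_quasi_trees j D = card {F. F \<subseteq> edges D \<and> quasi_tree j (spanning_sub D F)}"


section \<open>Link projections\<close>

text \<open>
  A crossing \<open>c\<close> has the four edge-ends \<open>(c, 0)\<close>, \<open>(c, 1)\<close>, \<open>(c, 2)\<close>, \<open>(c, 3)\<close> in counterclockwise
  order (arithmetic in the type \<open>4\<close> is modulo 4). As in planar diagram codes, the under-strand
  consists of the ends 0 and 2, the over-strand of the ends 1 and 3. The map \<open>glue\<close> pairs the two
  ends of each edge of the projection. The unbounded region of the plane is the one on the right of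
  the edge-end \<open>outer\<close>. A projection without crossings stands for a single simple closed curve.
\<close>

type_synonym 'c dart = "'c \<times> 4"

record 'c projection =
  crossings :: "'c set"
  glue :: "'c dart \<Rightarrow> 'c dart"
  outer :: "'c dart"

definition darts :: "'c projection \<Rightarrow> 'c dart set" where
  "darts P = crossings P \<times> UNIV"

definition plane_map :: "'c projection \<Rightarrow> ('c, 'c dart) dessin" where
  "plane_map P = \<lparr>verts = crossings P, ends = darts P, vert = fst, opp = glue P,
                  nxt = \<lambda>(c, i). (c, i + 1)\<rparr>"

definition connected_projection :: "'c projection \<Rightarrow> bool" where
  "connected_projection P \<longleftrightarrow>
     is_dessin (plane_map P) \<and> genus (plane_map P) = 0 \<and>
     (crossings P = {} \<or> num_components (plane_map P) = 1 \<and> outer P \<in> darts P)"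

text \<open>
  An orientation of the link is recorded as the set of those edge-ends at which the orientation
  points away from the crossing.
\<close>

definition orientation :: "'c projection \<Rightarrow> 'c dart set \<Rightarrow> bool" where
  "orientation P U \<longleftrightarrow> U \<subseteq> darts P \<and>
     (\<forall>d\<in>darts P. d \<in> U \<longleftrightarrow> glue P d \<notin> U) \<and>
     (\<forall>c\<in>crossings P. \<forall>i. (c, i) \<in> U \<longleftrightarrow> (c, i + 2) \<notin> U)"

definition positive_crossing :: "'c dart set \<Rightarrow> 'c \<Rightarrow> bool" where
  "positive_crossing U c \<longleftrightarrow> ((c, 1) \<in> U \<longleftrightarrow> (c, 2) \<in> U)"

text \<open>
  Rotating the over-strand counterclockwise onto the under-strand sweeps out the corner between the
  ends 1 and 2 and the corner between 3 and 0. The \<open>A\<close>-splicing joins these two corners, hence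
  reconnects 0 with 1 and 2 with 3; the \<open>B\<close>-splicing reconnects 1 with 2 and 3 with 0.
  In \<open>splice S\<close> the crossings in \<open>S\<close> are \<open>B\<close>-spliced and all others are \<open>A\<close>-spliced.
\<close>

definition splice :: "'c set \<Rightarrow> 'c dart \<Rightarrow> 'c dart" where
  "splice S = (\<lambda>(c, i). (c, if (i \<in> {0, 2}) = (c \<in> S) then i - 1 else i + 1))"

text \<open>
  A circle is represented by the set of edge-ends it passes through; the only circle that occurs for
  a projection without crossings passes through none.
\<close>

definition circle :: "'c projection \<Rightarrow> 'c set \<Rightarrow> 'c dart \<Rightarrow> 'c dart set" where
  "circle P S d = ({(d, glue P d) | d. d \<in> darts P} \<union> {(d, splice S d) | d. d \<in> darts P})\<^sup>* `` {d}"

definition circles :: "'c projection \<Rightarrow> 'c set \<Rightarrow> 'c dart set set" where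
  "circles P S = (if crossings P = {} then {{}} else circle P S ` darts P)"


section \<open>Jones polynomial and determinant\<close>

text \<open>
  Integral Laurent polynomials in one variable \<open>A\<close>; \<open>Poly_Mapping.single k a\<close> is \<open>a A\<^sup>k\<close>.
\<close>

type_synonym laurent_poly = "int \<Rightarrow>\<^sub>0 int"

definition laurent_eval :: "laurent_poly \<Rightarrow> complex \<Rightarrow> complex" where
  "laurent_eval p z = (\<Sum>k\<in>Poly_Mapping.keys p. of_int (Poly_Mapping.lookup p k) * z powi k)"

definition kauffman_bracket :: "'c projection \<Rightarrow> laurent_poly" where
  "kauffman_bracket P =
     (\<Sum>S\<in>Pow (crossings P).
        Poly_Mapping.single (int (card (crossings P - S)) - int (card S)) 1 *
        (- Poly_Mapping.single 2 1 - Poly_Mapping.single (-2) 1) ^ (card (circles P S) - 1))"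

text \<open>
  The Jones polynomial \<open>V(t)\<close>, written in the variable \<open>A = t\<^bsup>-1/4\<^esup>\<close>. The product is the factor
  \<open>(-A\<^sup>3)\<^bsup>-w\<^esup>\<close>, where \<open>w\<close> is the writhe.
\<close>

definition jones_poly :: "'c projection \<Rightarrow> 'c dart set \<Rightarrow> laurent_poly" where
  "jones_poly P U =
     (\<Prod>c\<in>crossings P. if positive_crossing U c
        then Poly_Mapping.single (-3) (-1) else Poly_Mapping.single 3 (-1)) *
     kauffman_bracket P"

definition jones :: "'c projection \<Rightarrow> 'c dart set \<Rightarrow> complex \<Rightarrow> complex" where
  "jones P U t = laurent_eval (jones_poly P U) (t powr (- 1 / 4))"

definition link_determinant :: "'c projection \<Rightarrow> 'c dart set \<Rightarrow> real" where
  "link_determinant P U = cmod (jones P U (-1))"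


section \<open>The all-A dessin\<close>

abbreviation A_circle :: "'c projection \<Rightarrow> 'c dart \<Rightarrow> 'c dart set" where
  "A_circle P \<equiv> circle P {}"

abbreviation A_circles :: "'c projection \<Rightarrow> 'c dart set set" where
  "A_circles P \<equiv> circles P {}"

abbreviation region :: "'c projection \<Rightarrow> 'c dart \<Rightarrow> 'c dart set" where
  "region P d \<equiv> face (plane_map P) d"

text \<open>
  Moving in the plane, after \<open>A\<close>-splicing, without meeting the circle \<open>X\<close>: one may cross the edges of
  the projection that do not belong to \<open>X\<close>, and pass through a crossing between its two joined
  corners. The corner between 1 and 2 lies on the right of \<open>(c, 2)\<close>, the one between 3 and 0 on the
  right of \<open>(c, 0)\<close>.
\<close>

definition region_step :: "'c projection \<Rightarrow> 'c dart set \<Rightarrow> ('c dart set \<times> 'c dart set) set" where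
  "region_step P X =
     {(region P d, region P (glue P d)) | d. d \<in> darts P - X} \<union>
     {(region P (c, i), region P (c, i + 2)) | c i. c \<in> crossings P \<and> i \<in> {0, 2}}"

definition inside_circle :: "'c projection \<Rightarrow> 'c dart set \<Rightarrow> 'c dart set \<Rightarrow> bool" where
  "inside_circle P X R \<longleftrightarrow> (region P (outer P), R) \<notin> (region_step P X)\<^sup>*"

text \<open>The number of circles inside of which \<open>Y\<close> lies.\<close>

definition depth :: "'c projection \<Rightarrow> 'c dart set \<Rightarrow> nat" where
  "depth P Y = card {X \<in> A_circles P. X \<noteq> Y \<and> (\<forall>d\<in>Y. inside_circle P X (region P d))}"

text \<open>
  The circle through \<open>d\<close> is anti-clockwise (its inside is on its left) if its depth is even and
  clockwise otherwise. \<open>forward P d\<close> says that it traverses the edge of \<open>d\<close> starting at the end \<open>d\<close>.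
\<close>

definition forward :: "'c projection \<Rightarrow> 'c dart \<Rightarrow> bool" where
  "forward P d \<longleftrightarrow>
     (inside_circle P (A_circle P d) (region P (glue P d)) \<longleftrightarrow> even (depth P (A_circle P d)))"

text \<open>
  The arc at the crossing \<open>c\<close> has one end, called \<open>(c, 0)\<close>, on the strand connecting the edge-ends 0
  and 1, and one end, called \<open>(c, 2)\<close>, on the strand connecting 2 and 3. The next arc-end after
  \<open>(c, i)\<close> is found by leaving its strand through the forward edge-end and following that edge.
\<close>

definition arc_end_of :: "'c dart \<Rightarrow> 'c dart" where
  "arc_end_of = (\<lambda>(c, i). (c, if i \<in> {0, 1} then 0 else 2))"

definition all_A_dessin :: "'c projection \<Rightarrow> ('c dart set, 'c dart) dessin" where
  "all_A_dessin P =
     \<lparr>verts = A_circles P,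
      ends = crossings P \<times> {0, 2},
      vert = A_circle P,
      opp = \<lambda>(c, i). (c, i + 2),
      nxt = \<lambda>(c, i). arc_end_of (glue P (THE d. d \<in> {(c, i), (c, i + 1)} \<and> forward P d))\<rparr>"

end

theory Submission
  imports Defs
begin

text \<open>
  At \<open>t = - 1\<close> the value of a circle in the state sum for the bracket vanishes, so the determinant is the
  absolute value of the sum of \<open>\<i>\<^bsup>|S|\<^esup>\<close> over the sets \<open>S\<close> of \<open>B\<close>-spliced crossings whose state is a
  single circle (\<open>link_determinant_eq_one_circle_sum\<close>). The theorem follows from two facts.

  The circles of the state \<open>S\<close> correspond to the faces of the spanning sub-dessin whose edges are the arcs
  at the crossings in \<open>S\<close> (\<open>card_circles_eq_num_faces\<close>). The orientation of the \<open>A\<close>-circles by their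
  nesting turns out to be the checkerboard one: the number of \<open>A\<close>-circles around a region changes by one
  across every edge of the projection, and an edge is directed so that this number is odd on its left.
  Hence the edge-ends at a crossing are directed inwards and outwards alternately, every splicing is
  coherent with this orientation, and walking along the circles of a state amounts to walking along the
  boundary of the ribbon surface. That the number changes by one is the Jordan curve theorem for
  \<open>A\<close>-circles (\<open>A_circle_Jordan\<close>). The combinatorial projection is spherical only in the sense of Euler's
  formula, from which the separation property is derived by showing that every even subgraph is the
  boundary of a set of faces modulo 2 (\<open>spherical_even_chain_bounds\<close>).

  In any dessin, adding an edge to a spanning sub-dessin composes the permutation that traces the boundary
  with a transposition, and so changes the number of faces by exactly one (\<open>num_faces_insert_edge\<close>). Since
  there are \<open>v\<close> faces when there are no edges, a sub-dessin with one face has \<open>v - 1 + 2 j\<close> edges for some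
  \<open>j\<close>, and comparison with the full dessin shows that \<open>j\<close> is at most its genus. One face also forces
  connectedness, so these sub-dessins are exactly the quasi-trees, and each of them contributes
  \<open>\<i>\<^bsup>v - 1\<^esup> (-1)\<^sup>j\<close> (\<open>one_face_sum_eq_quasi_tree_sum\<close>).
\<close>


section \<open>Orbits of a permutation of a finite set\<close>

lemma self_in_orbit_bij:
  assumes "finite A" "bij_betw f A A" "x \<in> A"
  shows "x \<in> orbit f x"
proof -
  have "bij_betw (perm_restrict f A) A A"
    using assms(2) by (subst bij_betw_cong[of A _ f]) (auto simp: perm_restrict_def)
  then have "perm_restrict f A permutes A"
    by (rule bij_imp_permutes) (auto simp: perm_restrict_def)
  then have "x \<in> orbit (perm_restrict f A) x"
    using assms(1) by (intro permutation_self_in_orbit) (auto simp: permutation_permutes)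
  also have "orbit (perm_restrict f A) x = orbit f x"
    using assms by (intro orbit_cong0[of x A]) (auto simp: perm_restrict_def bij_betw_def)
  finally show ?thesis .
qed

lemma orbit_subset_closed:
  assumes "f ` A \<subseteq> A" "x \<in> A"
  shows "orbit f x \<subseteq> A"
proof
  fix y assume "y \<in> orbit f x"
  then show "y \<in> A" by induct (use assms in auto)
qed

lemma orbit_subset_bij:
  assumes "bij_betw f A A" "x \<in> A"
  shows "orbit f x \<subseteq> A"
  using assms by (intro orbit_subset_closed) (auto simp: bij_betw_def)

lemma orbit_eq_bij:
  assumes "finite A" "bij_betw f A A" "x \<in> A" "y \<in> orbit f x"
  shows "orbit f y = orbit f x"
proof -
  have x: "x \<in> orbit f x" using assms self_in_orbit_bij by metis
  then have "x \<in> orbit f y" using assms(4) by (rule orbit_swap)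
  then show ?thesis using assms(4) by (auto intro: orbit_trans)
qed

text \<open>Going round a finite orbit, one comes from \<open>f y\<close> back to \<open>y\<close>.\<close>

lemma orbit_step_iff_bij:
  assumes "finite A" "bij_betw f A A" "x \<in> A" "y \<in> A"
  shows "f y \<in> orbit f x \<longleftrightarrow> y \<in> orbit f x"
proof -
  have "y \<in> orbit f (f y)"
    using self_in_orbit_step[OF self_in_orbit_bij[OF assms(1,2,4)]]
      self_in_orbit_bij[OF assms(1,2,4)] by simp
  then show ?thesis by (auto intro: orbit.step orbit_trans)
qed

definition num_orbits :: "('a \<Rightarrow> 'a) \<Rightarrow> 'a set \<Rightarrow> nat" where
  "num_orbits f A = card (orbit f ` A)"

lemma num_orbits_cong:
  assumes "bij_betw f A A" "\<And>x. x \<in> A \<Longrightarrow> f x = g x"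
  shows "num_orbits f A = num_orbits g A"
proof -
  have "orbit f x = orbit g x" if "x \<in> A" for x
    using assms that by (intro orbit_cong0[of x A]) (auto simp: bij_betw_def)
  then show ?thesis unfolding num_orbits_def by (metis image_cong)
qed

text \<open>
  The points that \<open>p\<close> passes on the way from \<open>p a\<close> to \<open>b\<close> do not include \<open>a\<close>, and they are closed under
  the new map, which sends \<open>b\<close> back to \<open>p a\<close>.
\<close>

lemma orbit_transpose_split:
  assumes "finite A" "bij_betw p A A" "a \<in> A" "a \<noteq> b" "b \<in> orbit p a"
  shows "b \<notin> orbit (p \<circ> Transposition.transpose a b) a"
proof
  define q where "q = p \<circ> Transposition.transpose a b"
  assume "b \<in> orbit (p \<circ> Transposition.transpose a b) a"
  then have ba: "b \<in> orbit q a" by (simp add: q_def)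
  have bA: "b \<in> A" using orbit_subset_bij[OF assms(2,3)] assms(5) by blast
  have "bij_betw (Transposition.transpose a b) A A"
    using assms(3) bA by (intro permutes_imp_bij permutes_swap_id) auto
  then have q: "bij_betw q A A" unfolding q_def using assms(2) bij_betw_trans by blast
  have "\<exists>k. 0 < k \<and> (p ^^ k) a = b" using assms(5) by (auto simp: orbit_altdef)
  define k where "k = (LEAST k. 0 < k \<and> (p ^^ k) a = b)"
  have k: "0 < k" "(p ^^ k) a = b"
    using LeastI_ex[OF \<open>\<exists>k. 0 < k \<and> (p ^^ k) a = b\<close>] by (auto simp: k_def)
  have least: "(p ^^ j) a \<noteq> b" if "0 < j" "j < k" for j
    using not_less_Least[of j "\<lambda>k. 0 < k \<and> (p ^^ k) a = b"] that by (auto simp: k_def)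
  have nota: "(p ^^ j) a \<noteq> a" if "0 < j" "j \<le> k" for j
  proof
    assume eq: "(p ^^ j) a = a"
    then have "j \<noteq> k" using k assms(4) by auto
    then have "(p ^^ (k - j)) a = b"
      using that k eq funpow_add[of "k - j" j p] by (auto simp: fun_eq_iff)
    then show False using least[of "k - j"] that \<open>j \<noteq> k\<close> by auto
  qed
  define Z where "Z = (\<lambda>j. (p ^^ j) a) ` {0<..k}"
  have "q ` Z \<subseteq> Z"
  proof
    fix y assume "y \<in> q ` Z"
    then obtain j where j: "0 < j" "j \<le> k" "q ((p ^^ j) a) = y" by (auto simp: Z_def)
    show "y \<in> Z"
    proof (cases "j = k")
      case True
      then have "y = (p ^^ 1) a" using j k by (simp add: q_def)
      then show ?thesis unfolding Z_def using k(1) by (intro image_eqI[of _ _ 1]) auto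
    next
      case False
      then have "y = (p ^^ Suc j) a" using j nota least by (simp add: q_def)
      then show ?thesis unfolding Z_def using j False by (intro image_eqI[of _ _ "Suc j"]) auto
    qed
  qed
  moreover have "b \<in> Z" unfolding Z_def using k by (intro image_eqI[of _ _ k]) auto
  ultimately have "orbit q b \<subseteq> Z" by (rule orbit_subset_closed)
  moreover have "a \<in> orbit q b"
    using orbit_eq_bij[OF assms(1) q assms(3) ba] self_in_orbit_bij[OF assms(1) q assms(3)] by simp
  ultimately have "a \<in> Z" by blast
  then obtain j where "j \<in> {0<..k}" "a = (p ^^ j) a" unfolding Z_def by (rule imageE)
  then show False using nota[of j] by auto
qed

text \<open>
  Composed with the transposition, \<open>p\<close> crosses over from the orbit of \<open>a\<close> to that of \<open>b\<close> at \<open>a\<close>, and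
  back at \<open>b\<close>, so that the two orbits become one.
\<close>

lemma num_orbits_transpose_merge:
  assumes A: "finite A" and p: "bij_betw p A A" and a: "a \<in> A" and b: "b \<in> A"
    and ab: "b \<notin> orbit p a"
  shows "num_orbits p A = Suc (num_orbits (p \<circ> Transposition.transpose a b) A)"
proof -
  define q where "q = p \<circ> Transposition.transpose a b"
  have "bij_betw (Transposition.transpose a b) A A"
    using a b by (intro permutes_imp_bij permutes_swap_id) auto
  then have q: "bij_betw q A A" unfolding q_def using p bij_betw_trans by blast
  note pa = self_in_orbit_bij[OF A p a] and pb = self_in_orbit_bij[OF A p b]
  have ne: "orbit p a \<noteq> orbit p b" using ab pb by auto
  have ba: "a \<notin> orbit p b" using orbit_eq_bij[OF A p b] ne by auto
  define T where "T = orbit p a \<union> orbit p b"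
  have qa: "q a = p b" and qb: "q b = p a" by (auto simp: q_def)
  have q': "q y = p y" if "y \<noteq> a" "y \<noteq> b" for y using that by (auto simp: q_def)
  have sub_b: "orbit p b \<subseteq> orbit q a"
  proof
    fix y assume y: "y \<in> orbit p b"
    then show "y \<in> orbit q a"
    proof induct
      case base then show ?case by (metis qa orbit.base)
    next
      case (step y)
      then have "y \<noteq> a" using ba by auto
      then have "p y = (if y = b then q a else q y)" using qa q' by simp
      then show ?case using step(2) by (auto intro: orbit.intros)
    qed
  qed
  have sub_a: "orbit p a \<subseteq> orbit q a"
  proof
    fix y assume y: "y \<in> orbit p a"
    then show "y \<in> orbit q a"
    proof induct
      case base then show ?case using sub_b pb qb by (metis orbit.step subsetD)
    next
      case (step y)
      then have "y \<noteq> b" using ab by auto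
      then have "p y = (if y = a then q b else q y)" using qb q' by simp
      then show ?case using step(2) sub_b pb by (auto intro: orbit.intros)
    qed
  qed
  have "q ` T \<subseteq> T"
  proof
    fix z assume "z \<in> q ` T"
    then obtain y where y: "y \<in> T" "z = q y" by blast
    then show "z \<in> T" unfolding T_def
      by (cases "y = a"; cases "y = b") (auto simp: qa qb q' intro: orbit.intros)
  qed
  then have "orbit q a \<subseteq> T" using pa by (intro orbit_subset_closed) (auto simp: T_def)
  then have oa: "orbit q a = T" using sub_a sub_b by (auto simp: T_def)
  have T: "orbit q x = T" if "x \<in> T" for x using orbit_eq_bij[OF A q a] that oa by auto
  have Tp: "orbit p x \<in> {orbit p a, orbit p b}" if "x \<in> T" for x
    using orbit_eq_bij[OF A p a, of x] orbit_eq_bij[OF A p b, of x] that unfolding T_def by blast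
  have off: "orbit q x = orbit p x" if "x \<in> A - T" for x
  proof (rule orbit_cong[OF self_in_orbit_bij[OF A p]])
    fix s assume s: "s \<in> orbit p x"
    then have "orbit p s = orbit p x" using orbit_eq_bij[OF A p] that by blast
    then have "s \<noteq> a" "s \<noteq> b" using that self_in_orbit_bij[OF A p, of x] by (auto simp: T_def)
    then show "q s = p s" using q' by auto
  qed (use that in auto)
  define R where "R = orbit p ` (A - T)"
  have TA: "T \<subseteq> A" using orbit_subset_bij[OF p] a b by (auto simp: T_def)
  have self: "x \<in> orbit p x" if "x \<in> A - T" for x using self_in_orbit_bij[OF A p] that by auto
  have "orbit p ` A = orbit p ` (A - T) \<union> orbit p ` T" using TA by blast
  also have "orbit p ` T = {orbit p a, orbit p b}" using Tp pa pb by (auto simp: T_def)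
  finally have P: "orbit p ` A = insert (orbit p a) (insert (orbit p b) R)"
    by (auto simp: R_def)
  have "orbit q ` A = orbit q ` (A - T) \<union> orbit q ` T" using TA by blast
  also have "orbit q ` T = {T}" using T pa by (auto simp: T_def)
  also have "orbit q ` (A - T) = R" unfolding R_def using off by (intro image_cong) auto
  finally have Q: "orbit q ` A = insert T R" by auto
  have "finite R" using A by (simp add: R_def)
  moreover have "orbit p a \<notin> R" "orbit p b \<notin> R" "T \<notin> R"
    using self by (auto simp: R_def T_def)
  ultimately show ?thesis
    using ne by (simp add: num_orbits_def P Q q_def[symmetric])
qed

text \<open>
  If \<open>a\<close> and \<open>b\<close> lie on one orbit, the composition separates them, so that composing once more with
  the transposition merges the two pieces again.
\<close>

lemma num_orbits_transpose:
  assumes A: "finite A" and p: "bij_betw p A A" and a: "a \<in> A" and b: "b \<in> A" and ab: "a \<noteq> b"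
  shows "num_orbits (p \<circ> Transposition.transpose a b) A = Suc (num_orbits p A) \<or>
    num_orbits p A = Suc (num_orbits (p \<circ> Transposition.transpose a b) A)"
proof (cases "b \<in> orbit p a")
  case True
  have "bij_betw (Transposition.transpose a b) A A"
    using a b by (intro permutes_imp_bij permutes_swap_id) auto
  then have "bij_betw (p \<circ> Transposition.transpose a b) A A" using p bij_betw_trans by blast
  from num_orbits_transpose_merge[OF A this a b orbit_transpose_split[OF A p a ab True]]
  show ?thesis by (simp add: comp_assoc)
next
  case False
  then show ?thesis using num_orbits_transpose_merge[OF A p a b] by simp
qed


section \<open>Faces of spanning sub-dessins\<close>

lemma dessin_nxt:
  assumes "is_dessin D" "d \<in> ends D"
  shows "orbit (nxt D) d = {e \<in> ends D. vert D e = vert D d}"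
proof (rule orbit_cyclic_eq3)
  show "cyclic_on (nxt D) {e \<in> ends D. vert D e = vert D d}"
    using assms by (simp add: is_dessin_def)
qed (use assms in simp)

lemma dessin_nxt_closed:
  assumes "is_dessin D" "d \<in> ends D"
  shows "nxt D d \<in> ends D" "vert D (nxt D d) = vert D d"
  using dessin_nxt[OF assms] orbit.base[of "nxt D" d] by auto

lemma dessin_bij_nxt:
  assumes "is_dessin D"
  shows "bij_betw (nxt D) (ends D) (ends D)"
proof -
  have fin: "finite (ends D)" using assms by (simp add: is_dessin_def)
  have "y \<in> nxt D ` ends D" if y: "y \<in> ends D" for y
  proof -
    have orb: "orbit (nxt D) y \<subseteq> ends D" and self: "y \<in> orbit (nxt D) y"
      using dessin_nxt[OF assms y] y by auto
    from self show ?thesis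
      by (cases rule: orbit.cases) (use y orb in auto)
  qed
  then have "nxt D ` ends D = ends D" using dessin_nxt_closed[OF assms] by auto
  then show ?thesis using fin by (simp add: bij_betw_def eq_card_imp_inj_on)
qed

lemma dessin_opp:
  assumes "is_dessin D" "d \<in> ends D"
  shows "opp D d \<in> ends D" "opp D d \<noteq> d" "opp D (opp D d) = d"
  using assms by (auto simp: is_dessin_def)

lemma Union_edges_subset:
  assumes "is_dessin D" "F \<subseteq> edges D"
  shows "\<Union>F \<subseteq> ends D"
  using assms(2) dessin_opp(1)[OF assms(1)] by (auto simp: edges_def)

lemma opp_mem_Union_edges:
  assumes "is_dessin D" "F \<subseteq> edges D" "d \<in> \<Union>F"
  shows "opp D d \<in> \<Union>F" "{d, opp D d} \<in> F"
proof -
  obtain e where e: "e \<in> F" "d \<in> e" using assms(3) by blast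
  then obtain x where x: "x \<in> ends D" "e = {x, opp D x}" using assms(2) by (auto simp: edges_def)
  then have "e = {d, opp D d}" using e dessin_opp[OF assms(1) x(1)] by auto
  then show "{d, opp D d} \<in> F" "opp D d \<in> \<Union>F" using e by auto
qed

lemma finite_edges: "is_dessin D \<Longrightarrow> finite (edges D)"
  by (simp add: edges_def is_dessin_def)

text \<open>
  The edges outside \<open>F\<close> are cut off at both ends: walking along a boundary component of the ribbon
  surface with edge set \<open>F\<close>, one turns around at the ends in \<open>F\<close> only. Unlike the first-return maps,
  this description keeps the set of ends fixed while \<open>F\<close> varies.
\<close>

definition opp_on :: "('v, 'e) dessin \<Rightarrow> 'e set set \<Rightarrow> 'e \<Rightarrow> 'e" where
  "opp_on D F d = (if d \<in> \<Union>F then opp D d else d)"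

lemma bij_opp_on:
  assumes "is_dessin D" "F \<subseteq> edges D"
  shows "bij_betw (opp_on D F) (ends D) (ends D)"
proof (rule bij_betw_byWitness[where f' = "opp_on D F"])
  show "\<forall>d\<in>ends D. opp_on D F (opp_on D F d) = d"
    using opp_mem_Union_edges[OF assms] dessin_opp[OF assms(1)] by (auto simp: opp_on_def)
  then show "\<forall>d\<in>ends D. opp_on D F (opp_on D F d) = d" .
qed (use dessin_opp[OF assms(1)] in \<open>auto simp: opp_on_def\<close>)

lemma bij_boundary_walk:
  assumes "is_dessin D" "F \<subseteq> edges D"
  shows "bij_betw (nxt D \<circ> opp_on D F) (ends D) (ends D)"
  using bij_betw_trans[OF bij_opp_on[OF assms] dessin_bij_nxt[OF assms(1)]] .

lemma orbit_first_return:
  assumes A: "finite A" "bij_betw g A A" and B: "B \<subseteq> A"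
    and h: "\<And>x. x \<in> B \<Longrightarrow> h x = (g ^^ (LEAST n. 0 < n \<and> (g ^^ n) x \<in> B)) x"
    and x: "x \<in> B"
  shows "orbit h x = orbit g x \<inter> B"
proof
  have ret: "\<exists>n. 0 < n \<and> (g ^^ n) y \<in> B" if "y \<in> B" for y
  proof -
    have "y \<in> orbit g y" using self_in_orbit_bij[OF A] B that by auto
    then show ?thesis using that by (auto simp: orbit_altdef)
  qed
  have hB: "h y \<in> orbit g y \<inter> B" if "y \<in> B" for y
    using LeastI_ex[OF ret[OF that]] h[OF that] by (auto simp: orbit_altdef)
  show "orbit h x \<subseteq> orbit g x \<inter> B"
  proof
    fix y assume "y \<in> orbit h x"
    then show "y \<in> orbit g x \<inter> B"
    proof induct
      case base
      then show ?case using hB[OF x] .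
    next
      case (step y)
      then have "h y \<in> orbit g y \<inter> B" using hB by blast
      then show ?case using step(2) orbit_trans[of "h y" g y x] by blast
    qed
  qed
  have "(g ^^ n) y \<in> orbit h y" if "0 < n" "y \<in> B" "(g ^^ n) y \<in> B" for n y
    using that
  proof (induction n arbitrary: y rule: less_induct)
    case (less n)
    define m where "m = (LEAST n. 0 < n \<and> (g ^^ n) y \<in> B)"
    have m: "0 < m" "(g ^^ m) y = h y" "h y \<in> B"
      using LeastI_ex[OF ret[OF less.prems(2)]] h[OF less.prems(2)] by (auto simp: m_def)
    have "m \<le> n" unfolding m_def using less.prems by (intro Least_le) auto
    show ?case
    proof (cases "m = n")
      case True
      then show ?thesis using m by (auto intro: orbit.base)
    next
      case False
      have "(g ^^ n) y = (g ^^ (n - m)) (h y)"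
        using \<open>m \<le> n\<close> m(2) funpow_add[of "n - m" m g] by (auto simp: fun_eq_iff)
      moreover have "(g ^^ (n - m)) (h y) \<in> orbit h (h y)"
        using less.IH[of "n - m" "h y"] less.prems m False \<open>m \<le> n\<close> calculation by auto
      ultimately show ?thesis using orbit_subset by metis
    qed
  qed
  then show "orbit g x \<inter> B \<subseteq> orbit h x" using x by (auto simp: orbit_altdef)
qed

text \<open>
  Having turned around at an end in \<open>F\<close>, the boundary walk runs through ends outside \<open>F\<close> by \<open>nxt\<close> until it
  meets \<open>F\<close> again. Its first return to \<open>F\<close> is thus the face permutation of the sub-dessin.
\<close>

lemma face_spanning_sub:
  assumes D: "is_dessin D" and F: "F \<subseteq> edges D" and d: "d \<in> \<Union>F"
  shows "face (spanning_sub D F) d = orbit (nxt D \<circ> opp_on D F) d \<inter> \<Union>F"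
proof -
  define B where "B = \<Union>F"
  define g where "g = nxt D \<circ> opp_on D F"
  have BE: "B \<subseteq> ends D" using Union_edges_subset[OF D F] by (simp add: B_def)
  have fin: "finite (ends D)" using D by (simp add: is_dessin_def)
  have ret: "nxt (spanning_sub D F) (opp D x) = (g ^^ (LEAST n. 0 < n \<and> (g ^^ n) x \<in> B)) x"
    if x: "x \<in> B" for x
  proof -
    have ox: "opp D x \<in> B" using opp_mem_Union_edges[OF D F] x by (simp add: B_def)
    have oo: "opp D x \<in> orbit (nxt D) (opp D x)" using ox BE dessin_nxt[OF D] by auto
    define N where "N = (LEAST n. 0 < n \<and> (nxt D ^^ n) (opp D x) \<in> B)"
    have "\<exists>n. 0 < n \<and> (nxt D ^^ n) (opp D x) \<in> B" using oo ox by (auto simp: orbit_altdef)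
    from LeastI_ex[OF this] have N: "0 < N" "(nxt D ^^ N) (opp D x) \<in> B" by (auto simp: N_def)
    have before: "(nxt D ^^ m) (opp D x) \<notin> B" if "0 < m" "m < N" for m
      using not_less_Least[of m "\<lambda>n. 0 < n \<and> (nxt D ^^ n) (opp D x) \<in> B"] that by (auto simp: N_def)
    have eq: "(g ^^ m) x = (nxt D ^^ m) (opp D x)" if "0 < m" "m \<le> N" for m
      using that
    proof (induction m)
      case (Suc m)
      then show ?case
        using x before[of m] by (cases "m = 0") (auto simp: g_def opp_on_def B_def)
    qed auto
    have "(LEAST n. 0 < n \<and> (g ^^ n) x \<in> B) = N"
      using N eq before by (intro Least_equality) (auto, metis less_imp_le_nat not_le)
    then show ?thesis using eq[of N] N by (simp add: spanning_sub_def N_def B_def)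
  qed
  have "orbit (nxt (spanning_sub D F) \<circ> opp D) d = orbit g d \<inter> B"
    using ret d bij_boundary_walk[OF D F]
    by (intro orbit_first_return[OF fin _ BE]) (simp_all add: g_def B_def)
  then show ?thesis by (simp add: face_def g_def B_def spanning_sub_def)
qed

text \<open>
  The boundary walks that meet \<open>F\<close> correspond to the faces through edges. A boundary walk that misses
  \<open>F\<close> goes once around a vertex that is isolated in the sub-dessin.
\<close>

lemma num_faces_spanning_sub:
  assumes D: "is_dessin D" and F: "F \<subseteq> edges D"
  shows "num_faces (spanning_sub D F) =
    num_orbits (nxt D \<circ> opp_on D F) (ends D) + card (verts D - vert D ` ends D)"
proof -
  define B where "B = \<Union>F"
  define g where "g = nxt D \<circ> opp_on D F"
  have BE: "B \<subseteq> ends D" using Union_edges_subset[OF D F] by (simp add: B_def)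
  have fin: "finite (ends D)" "finite (verts D)" and VE: "vert D ` ends D \<subseteq> verts D"
    using D by (auto simp: is_dessin_def)
  have g: "bij_betw g (ends D) (ends D)" unfolding g_def by (rule bij_boundary_walk[OF D F])
  note self = self_in_orbit_bij[OF fin(1) g]
  have eq: "orbit g x = orbit g y" if "x \<in> ends D" "y \<in> orbit g x" for x y
    using orbit_eq_bij[OF fin(1) g that] by simp

  have "face (spanning_sub D F) ` B = (\<lambda>Z. Z \<inter> B) ` orbit g ` B"
    using face_spanning_sub[OF D F] by (auto simp: image_image B_def g_def)
  moreover have "inj_on (\<lambda>Z. Z \<inter> B) (orbit g ` B)"
  proof (rule inj_onI, clarify)
    fix x y assume xy: "x \<in> B" "y \<in> B" "orbit g x \<inter> B = orbit g y \<inter> B"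
    then have "y \<in> orbit g x" using self BE by blast
    then show "orbit g x = orbit g y" using eq xy BE by blast
  qed
  ultimately have c1: "card (face (spanning_sub D F) ` B) = card (orbit g ` B)"
    by (simp add: card_image)

  define N where "N = {x \<in> ends D. orbit g x \<inter> B = {}}"
  define S where "S = (\<lambda>v. {d \<in> ends D. vert D d = v})"
  have free: "orbit g x = S (vert D x)" if x: "x \<in> ends D" and no: "S (vert D x) \<inter> B = {}" for x
  proof -
    have orb: "orbit (nxt D) x = S (vert D x)" using dessin_nxt[OF D x] by (simp add: S_def)
    have "orbit g x = orbit (nxt D) x"
    proof (rule orbit_cong)
      show "x \<in> orbit (nxt D) x" using orb x by (simp add: S_def)
      show "g s = nxt D s" if "s \<in> orbit (nxt D) x" for s
        using that no by (auto simp: orb g_def opp_on_def B_def)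
    qed
    then show ?thesis using orb by simp
  qed
  have N: "x \<in> N \<longleftrightarrow> x \<in> ends D \<and> S (vert D x) \<inter> B = {}" for x
  proof
    assume x: "x \<in> N"
    then have "orbit (nxt D) x = orbit g x"
      using self by (intro orbit_cong) (auto simp: N_def g_def opp_on_def B_def)
    then show "x \<in> ends D \<and> S (vert D x) \<inter> B = {}"
      using x dessin_nxt[OF D] by (auto simp: N_def S_def)
  next
    assume "x \<in> ends D \<and> S (vert D x) \<inter> B = {}"
    then show "x \<in> N" using free by (simp add: N_def)
  qed
  have "orbit g ` N = S ` vert D ` N" using free N by (auto simp: image_image intro!: image_cong)
  moreover have "vert D ` N = vert D ` ends D - vert D ` B"
  proof
    show "vert D ` N \<subseteq> vert D ` ends D - vert D ` B"
    proof
      fix v assume "v \<in> vert D ` N"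
      then obtain x where x: "x \<in> ends D" "S v \<inter> B = {}" "v = vert D x" by (auto simp: N)
      moreover have "v \<notin> vert D ` B" using x(2) BE by (auto simp: S_def)
      ultimately show "v \<in> vert D ` ends D - vert D ` B" by blast
    qed
    show "vert D ` ends D - vert D ` B \<subseteq> vert D ` N"
    proof
      fix v assume v: "v \<in> vert D ` ends D - vert D ` B"
      then obtain x where x: "x \<in> ends D" "v = vert D x" by blast
      moreover have "S (vert D x) \<inter> B = {}" 
      proof (rule equals0I)
        fix y assume "y \<in> S (vert D x) \<inter> B"
        then have "v \<in> vert D ` B" using x(2) by (intro image_eqI[of _ _ y]) (auto simp: S_def)
        then show False using v by simp
      qed
      ultimately show "v \<in> vert D ` N" using N by blast
    qed
  qed
  moreover have "inj_on S (vert D ` ends D)" by (rule inj_onI) (auto simp: S_def)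
  ultimately have c2: "card (orbit g ` N) = card (vert D ` ends D - vert D ` B)"
    by (simp add: card_image inj_on_diff)

  have "orbit g ` (ends D - N) = orbit g ` B"
  proof
    show "orbit g ` (ends D - N) \<subseteq> orbit g ` B" using eq by (auto simp: N_def) blast
    show "orbit g ` B \<subseteq> orbit g ` (ends D - N)" using self BE by (auto simp: N_def)
  qed
  moreover have "ends D = (ends D - N) \<union> N" by (auto simp: N_def)
  ultimately have "orbit g ` ends D = orbit g ` B \<union> orbit g ` N" by (metis image_Un)
  moreover have "orbit g ` B \<inter> orbit g ` N = {}" using self BE by (auto simp: N_def)
  ultimately have "num_orbits g (ends D) = card (orbit g ` B) + card (orbit g ` N)"
    using fin BE by (simp add: num_orbits_def card_Un_disjoint N_def finite_subset)
  moreover have "verts D - vert D ` B =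
      (verts D - vert D ` ends D) \<union> (vert D ` ends D - vert D ` B)"
    using VE BE by auto
  then have "card (verts D - vert D ` B) =
      card (verts D - vert D ` ends D) + card (vert D ` ends D - vert D ` B)"
    using fin by (simp only:) (rule card_Un_disjoint, auto)
  ultimately show ?thesis
    using c1 c2 by (simp add: num_faces_def g_def B_def spanning_sub_def)
qed

lemma num_faces_spanning_sub_empty: "num_faces (spanning_sub D {}) = card (verts D)"
  by (simp add: num_faces_def spanning_sub_def)

lemma num_faces_spanning_sub_edges:
  assumes "is_dessin D"
  shows "num_faces (spanning_sub D (edges D)) = num_faces D"
proof -
  have "\<Union>(edges D) = ends D" using assms by (auto simp: edges_def is_dessin_def)
  then have "num_orbits (nxt D \<circ> opp_on D (edges D)) (ends D) =
      num_orbits (nxt D \<circ> opp D) (ends D)"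
    by (intro num_orbits_cong bij_boundary_walk assms) (auto simp: opp_on_def)
  then show ?thesis
    using assms
    by (simp add: num_faces_spanning_sub num_faces_def[of D] num_orbits_def face_def[abs_def])
qed

text \<open>Adding an edge composes the boundary walk with the transposition of the ends of the edge.\<close>

lemma num_faces_insert_edge:
  assumes D: "is_dessin D" and F: "F \<subseteq> edges D" and e: "e \<in> edges D" "e \<notin> F"
  shows "num_faces (spanning_sub D (insert e F)) = Suc (num_faces (spanning_sub D F)) \<or>
    num_faces (spanning_sub D F) = Suc (num_faces (spanning_sub D (insert e F)))"
proof -
  obtain d where d: "d \<in> ends D" "e = {d, opp D d}" using e(1) by (auto simp: edges_def)
  note o = dessin_opp[OF D d(1)]
  have new: "d \<notin> \<Union>F" "opp D d \<notin> \<Union>F"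
    using opp_mem_Union_edges(2)[OF D F, of d] opp_mem_Union_edges(2)[OF D F, of "opp D d"] e(2) d o
    by (auto simp: insert_commute)
  have "opp_on D (insert e F) = opp_on D F \<circ> Transposition.transpose d (opp D d)"
  proof
    fix x
    show "opp_on D (insert e F) x = (opp_on D F \<circ> Transposition.transpose d (opp D d)) x"
      using new o by (cases "x = d"; cases "x = opp D d") (auto simp: opp_on_def d(2))
  qed
  then have "nxt D \<circ> opp_on D (insert e F) =
      (nxt D \<circ> opp_on D F) \<circ> Transposition.transpose d (opp D d)"
    by (simp add: comp_assoc)
  moreover have "finite (ends D)" using D by (simp add: is_dessin_def)
  ultimately show ?thesis
    using num_orbits_transpose[OF _ bij_boundary_walk[OF D F] d(1) o(1) o(2)[symmetric]] F e(1)
    by (simp add: num_faces_spanning_sub[OF D])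
qed

lemma num_faces_add_edges:
  assumes D: "is_dessin D" and "F \<subseteq> G" "G \<subseteq> edges D"
  shows "even (num_faces (spanning_sub D F) + num_faces (spanning_sub D G) + card (G - F))"
    and "num_faces (spanning_sub D F) \<le> num_faces (spanning_sub D G) + card (G - F)"
    and "num_faces (spanning_sub D G) \<le> num_faces (spanning_sub D F) + card (G - F)"
proof -
  let ?n = "\<lambda>F. num_faces (spanning_sub D F)"
  have "even (?n F + ?n (F \<union> K) + card K) \<and> ?n F \<le> ?n (F \<union> K) + card K \<and>
      ?n (F \<union> K) \<le> ?n F + card K"
    if "finite K" "K \<inter> F = {}" "K \<subseteq> edges D" for K
    using that
  proof (induction K rule: finite_induct)
    case (insert e K)
    have "?n (insert e (F \<union> K)) = Suc (?n (F \<union> K)) \<or> ?n (F \<union> K) = Suc (?n (insert e (F \<union> K)))"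
      using insert assms by (intro num_faces_insert_edge[OF D]) auto
    then show ?case using insert by auto
  qed simp
  from this[of "G - F"] have "even (?n F + ?n G + card (G - F)) \<and> ?n F \<le> ?n G + card (G - F) \<and>
      ?n G \<le> ?n F + card (G - F)"
    using assms finite_subset[of "G - F", OF _ finite_edges[OF D]]
    by (simp add: Un_absorb1 Diff_Int_distrib2 subset_iff)
  then show "even (?n F + ?n G + card (G - F))" "?n F \<le> ?n G + card (G - F)"
    "?n G \<le> ?n F + card (G - F)" by auto
qed


section \<open>Quasi-trees as one-face spanning sub-dessins\<close>

lemma edges_spanning_sub:
  assumes "is_dessin D" "F \<subseteq> edges D"
  shows "edges (spanning_sub D F) = F"
proof
  show "edges (spanning_sub D F) \<subseteq> F"
    using opp_mem_Union_edges(2)[OF assms] by (auto simp: edges_def spanning_sub_def)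
  show "F \<subseteq> edges (spanning_sub D F)"
  proof
    fix e assume e: "e \<in> F"
    then obtain d where "e = {d, opp D d}" using assms(2) by (auto simp: edges_def)
    then show "e \<in> edges (spanning_sub D F)" using e
      by (auto simp: edges_def spanning_sub_def intro!: image_eqI[of _ _ d] bexI[of _ e])
  qed
qed

text \<open>
  If there is an edge at all, a single face leaves no isolated vertex and passes through all ends of
  edges. Consecutive ends on a boundary walk lie at equal or adjacent vertices.
\<close>

lemma one_face_connected:
  assumes D: "is_dessin D" and F: "F \<subseteq> edges D" and one: "num_faces (spanning_sub D F) = 1"
  shows "num_components (spanning_sub D F) = 1"
proof -
  define H where "H = spanning_sub D F"
  define B where "B = \<Union>F"
  have H: "verts H = verts D" "ends H = B" "vert H = vert D" "opp H = opp D"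
    by (auto simp: H_def B_def spanning_sub_def)
  have BE: "B \<subseteq> ends D" using Union_edges_subset[OF D F] by (simp add: B_def)
  have fin: "finite (ends D)" "finite (verts D)" using D by (auto simp: is_dessin_def)
  have "finite B" using fin BE finite_subset by blast
  have count: "card (face H ` B) + card (verts D - vert D ` B) = 1"
    using one by (simp add: num_faces_def H flip: H_def)
  show ?thesis
  proof (cases "B = {}")
    case True
    then obtain v where "verts D = {v}" using count by (auto simp: card_1_singleton_iff)
    then show ?thesis by (simp add: num_components_def H flip: H_def)
  next
    case False
    have "card (face H ` B) \<noteq> 0" using False \<open>finite B\<close> by simp
    then have c: "card (face H ` B) = 1" "card (verts D - vert D ` B) = 0" using count by auto
    then obtain f where f: "face H ` B = {f}" by (auto simp: card_1_singleton_iff)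
    have verts: "verts D = vert D ` B" using c(2) fin BE D by (auto simp: is_dessin_def)
    have inB: "face H d = orbit (nxt D \<circ> opp_on D F) d \<inter> B" if "d \<in> B" for d
      using face_spanning_sub[OF D F] that by (simp add: H_def B_def)
    have reach: "(vert D d, vert D e) \<in> (adjacent H)\<^sup>*" if d: "d \<in> B" and e: "e \<in> B" for d e
    proof -
      have "e \<in> face H e"
        using inB[OF e] e self_in_orbit_bij[OF fin(1) bij_boundary_walk[OF D F], of e] BE by auto
      moreover have "face H e \<in> {f}" "face H d \<in> {f}" using d e by (auto simp flip: f)
      ultimately have "e \<in> orbit (nxt D \<circ> opp_on D F) d" using inB[OF d] by auto
      then show ?thesis
      proof induct
        case base
        have "vert D (nxt D (opp D d)) = vert D (opp D d)"
          using d BE dessin_nxt_closed(2)[OF D] dessin_opp[OF D] by auto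
        then show ?case using d by (auto simp: opp_on_def adjacent_def H B_def[symmetric])
      next
        case (step y)
        have y: "y \<in> ends D"
          using orbit_subset_bij[OF bij_boundary_walk[OF D F]] step(1) d BE by blast
        show ?case
        proof (cases "y \<in> B")
          case True
          have "vert D (nxt D (opp D y)) = vert D (opp D y)"
            using y dessin_nxt_closed(2)[OF D] dessin_opp[OF D] by auto
          then have "(vert D y, vert D ((nxt D \<circ> opp_on D F) y)) \<in> adjacent H"
            using True by (auto simp: opp_on_def adjacent_def H B_def[symmetric])
          then show ?thesis using step(2) by simp
        next
          case False
          then show ?thesis using step(2) y dessin_nxt_closed(2)[OF D]
            by (simp add: opp_on_def B_def[symmetric])
        qed
      qed
    qed
    have "(adjacent H)\<^sup>* `` {v} = verts D" if v: "v \<in> verts D" for v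
    proof
      have "w \<in> verts D" if "(v, w) \<in> (adjacent H)\<^sup>*" for w
        using that v
      proof induct
        case (step x y)
        then obtain d where "d \<in> B" "y = vert D (opp D d)" by (auto simp: adjacent_def H)
        then show ?case using dessin_opp(1)[OF D] BE D by (auto simp: is_dessin_def)
      qed
      then show "(adjacent H)\<^sup>* `` {v} \<subseteq> verts D" by auto
      show "verts D \<subseteq> (adjacent H)\<^sup>* `` {v}" using v reach unfolding verts by auto
    qed
    then have "(\<lambda>v. (adjacent H)\<^sup>* `` {v}) ` verts D = {verts D}"
      using False verts by auto
    then show ?thesis by (simp add: num_components_def H flip: H_def)
  qed
qed

lemma quasi_tree_spanning_sub_iff:
  assumes "is_dessin D" "F \<subseteq> edges D"
  shows "quasi_tree j (spanning_sub D F) \<longleftrightarrow>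
    num_faces (spanning_sub D F) = 1 \<and> card F + 1 = card (verts D) + 2 * j"
proof -
  have v: "verts (spanning_sub D F) = verts D" by (simp add: spanning_sub_def)
  have "genus (spanning_sub D F) = of_nat j"
    if "num_faces (spanning_sub D F) = 1" "card F + 1 = card (verts D) + 2 * j"
  proof -
    have "(of_nat (card F) :: rat) + 1 = of_nat (card (verts D)) + 2 * of_nat j"
      using arg_cong[OF that(2), of "of_nat :: nat \<Rightarrow> rat"] by simp
    then show ?thesis
      using one_face_connected[OF assms that(1)] that(1)
      by (simp add: genus_def v edges_spanning_sub[OF assms])
  qed
  then show ?thesis
    using one_face_connected[OF assms]
    by (auto simp: quasi_tree_def v edges_spanning_sub[OF assms])
qed

text \<open>
  Since one edge changes the number of faces by exactly one, the \<open>v\<close> faces of the edgeless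
  sub-dessin can be reduced to one only by \<open>v - 1 + 2 j\<close> edges, and the remaining edges produce too few
  faces of the whole dessin for its genus to be less than \<open>j\<close>.
\<close>

lemma one_face_genus_bound:
  assumes D: "is_dessin D" and F: "F \<subseteq> edges D" and one: "num_faces (spanning_sub D F) = 1"
  obtains j where "card F + 1 = card (verts D) + 2 * j" "of_nat j \<le> genus D"
proof -
  have fin: "finite (ends D)" "finite (verts D)" "vert D ` ends D \<subseteq> verts D"
    using D by (auto simp: is_dessin_def)
  have "verts D \<noteq> {}"
  proof
    assume "verts D = {}"
    then have "ends D = {}" using fin by auto
    then show False using one \<open>verts D = {}\<close>
      by (simp add: num_faces_spanning_sub[OF D F] num_orbits_def)
  qed
  then have "num_components D \<noteq> 0" using fin by (simp add: num_components_def)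
  then have k: "(1 :: rat) \<le> of_nat (num_components D)" by (simp add: Suc_leI)
  have ev: "even (card (verts D) + 1 + card F)" and le: "card (verts D) \<le> 1 + card F"
    using num_faces_add_edges[OF D empty_subsetI F] one by (auto simp: num_faces_spanning_sub_empty)
  obtain j where j: "card F + 1 = card (verts D) + 2 * j"
  proof -
    have "even (card F + 1 - card (verts D))" using ev le by auto
    then obtain j where "card F + 1 - card (verts D) = 2 * j" by (rule evenE)
    then have "card F + 1 = card (verts D) + 2 * j" using le by arith
    then show ?thesis by (rule that)
  qed
  have "card F \<le> card (edges D)" using F finite_edges[OF D] card_mono by blast
  moreover have "card (edges D - F) = card (edges D) - card F"
    using F finite_edges[OF D] by (simp add: card_Diff_subset finite_subset)
  ultimately have "num_faces D + card F \<le> 1 + card (edges D)"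
    using num_faces_add_edges(3)[OF D F order_refl] one
    by (simp add: num_faces_spanning_sub_edges[OF D])
  then have "(of_nat (num_faces D) :: rat) + of_nat (card F) \<le> 1 + of_nat (card (edges D))"
    by (metis of_nat_1 of_nat_add of_nat_le_iff)
  moreover have "(of_nat (card F) :: rat) + 1 = of_nat (card (verts D)) + 2 * of_nat j"
    using arg_cong[OF j, of "of_nat :: nat \<Rightarrow> rat"] by simp
  ultimately have "of_nat j \<le> genus D" using k by (simp add: genus_def)
  then show ?thesis using that j by blast
qed

lemma one_face_sum_eq_quasi_tree_sum:
  assumes D: "is_dessin D"
  shows "(\<Sum>F | F \<subseteq> edges D \<and> num_faces (spanning_sub D F) = 1. \<i> ^ card F) =
    \<i> ^ (card (verts D) - 1) *
      complex_of_real (\<Sum>j = 0..nat \<lfloor>genus D\<rfloor>. (-1) ^ j * real (num_quasi_trees j D))"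
proof -
  define Q where "Q = (\<lambda>j. {F. F \<subseteq> edges D \<and> quasi_tree j (spanning_sub D F)})"
  define J where "J = {0..nat \<lfloor>genus D\<rfloor>}"
  have Q: "Q j = {F. F \<subseteq> edges D \<and> num_faces (spanning_sub D F) = 1 \<and>
      card F + 1 = card (verts D) + 2 * j}" for j
    using quasi_tree_spanning_sub_iff[OF D] by (auto simp: Q_def)
  have fin: "finite (Q j)" for j
    using finite_edges[OF D] by (simp add: Q_def)
  have "{F. F \<subseteq> edges D \<and> num_faces (spanning_sub D F) = 1} = (\<Union>j\<in>J. Q j)"
  proof
    show "{F. F \<subseteq> edges D \<and> num_faces (spanning_sub D F) = 1} \<subseteq> (\<Union>j\<in>J. Q j)"
    proof clarify
      fix F assume F: "F \<subseteq> edges D" "num_faces (spanning_sub D F) = 1"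
      obtain j where j: "card F + 1 = card (verts D) + 2 * j" "of_nat j \<le> genus D"
        using one_face_genus_bound[OF D F] .
      then have "int j \<le> \<lfloor>genus D\<rfloor>" by (simp add: le_floor_iff)
      then show "F \<in> (\<Union>j\<in>J. Q j)" using F j by (auto simp: Q J_def)
    qed
  qed (auto simp: Q)
  then have "(\<Sum>F | F \<subseteq> edges D \<and> num_faces (spanning_sub D F) = 1. \<i> ^ card F) =
      (\<Sum>j\<in>J. \<Sum>F\<in>Q j. \<i> ^ card F)"
    using fin by (simp add: J_def) (rule sum.UNION_disjoint, auto simp: Q)
  also have "\<dots> = (\<Sum>j\<in>J. \<Sum>F\<in>Q j. \<i> ^ (card (verts D) - 1) * (-1) ^ j)"
  proof (intro sum.cong refl)
    fix j F assume F: "F \<in> Q j"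
    have "card (verts D) \<noteq> 0"
    proof
      assume "card (verts D) = 0"
      then have "ends D = {}" "verts D = {}" using D by (auto simp: is_dessin_def)
      then show False using F D
        by (auto simp: Q num_faces_spanning_sub num_orbits_def)
    qed
    then have "card F = card (verts D) - 1 + 2 * j" using F by (auto simp: Q)
    then show "\<i> ^ card F = \<i> ^ (card (verts D) - 1) * (-1) ^ j"
      by (simp add: power_add power_mult)
  qed
  also have "\<dots> = \<i> ^ (card (verts D) - 1) *
      complex_of_real (\<Sum>j\<in>J. (-1) ^ j * real (card (Q j)))"
    by (simp add: sum_distrib_left mult_ac)
  finally show ?thesis by (simp add: J_def num_quasi_trees_def Q_def)
qed


section \<open>Even subgraphs of spherical dessins bound\<close>

lemma odd_card_sym_diff:
  assumes "finite A" "finite B"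
  shows "odd (card ((A - B) \<union> (B - A))) \<longleftrightarrow> odd (card A) \<noteq> odd (card B)"
proof -
  have "card ((A - B) \<union> (B - A)) = card (A - B) + card (B - A)"
    using assms by (intro card_Un_disjoint) auto
  moreover have "card A = card (A - B) + card (A \<inter> B)" "card B = card (B - A) + card (A \<inter> B)"
    using assms card_Un_disjoint[of "A - B" "A \<inter> B"] card_Un_disjoint[of "B - A" "A \<inter> B"]
    by (auto simp: card_Diff_subset_Int Int_commute card_mono)
  ultimately show ?thesis by auto
qed

lemma face_nxt:
  assumes D: "is_dessin D" and d: "d \<in> ends D"
  shows "face D (nxt D d) = face D (opp D d)"
proof -
  have "bij_betw (nxt D \<circ> opp D) (ends D) (ends D)"
  proof (subst bij_betw_cong)
    show "bij_betw (nxt D \<circ> opp_on D (edges D)) (ends D) (ends D)"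
      by (rule bij_boundary_walk[OF D order_refl])
    have "\<Union>(edges D) = ends D" using D by (auto simp: edges_def is_dessin_def)
    then show "(nxt D \<circ> opp D) e = (nxt D \<circ> opp_on D (edges D)) e" if "e \<in> ends D" for e
      using that by (simp add: opp_on_def)
  qed
  moreover have "nxt D d \<in> orbit (nxt D \<circ> opp D) (opp D d)"
    using dessin_opp(3)[OF D d] orbit.base[of "nxt D \<circ> opp D" "opp D d"] by simp
  moreover have "finite (ends D)" using D by (simp add: is_dessin_def)
  ultimately show ?thesis
    unfolding face_def using dessin_opp(1)[OF D d] by (intro orbit_eq_bij)
qed

lemma adjacent_connected:
  assumes "num_components D = 1" "u \<in> verts D" "v \<in> verts D"
  shows "(u, v) \<in> (adjacent D)\<^sup>*"
proof -
  obtain Z where "(\<lambda>v. (adjacent D)\<^sup>* `` {v}) ` verts D = {Z}"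
    using assms(1) by (auto simp: num_components_def card_1_singleton_iff)
  then have "(adjacent D)\<^sup>* `` {u} = (adjacent D)\<^sup>* `` {v}" 
    using assms(2,3) by (metis imageI singletonD)
  then show ?thesis by blast
qed

text \<open>
  In a connected dessin the permutations \<open>nxt\<close> and \<open>opp\<close> of the ends generate a transitive group.
\<close>

lemma connected_ends_induct:
  assumes D: "is_dessin D" and con: "num_components D = 1"
    and nxt: "\<And>d. d \<in> ends D \<Longrightarrow> Q d \<Longrightarrow> Q (nxt D d)"
    and opp: "\<And>d. d \<in> ends D \<Longrightarrow> Q d \<Longrightarrow> Q (opp D d)"
    and d: "d \<in> ends D" "Q d" and e: "e \<in> ends D"
  shows "Q e"
proof -
  have vert: "Q y" if "x \<in> ends D" "Q x" "y \<in> ends D" "vert D y = vert D x" for x y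
  proof -
    have "y \<in> orbit (nxt D) x" using dessin_nxt[OF D that(1)] that by simp
    then have "y \<in> ends D \<and> Q y"
      by induct (use that nxt dessin_nxt_closed(1)[OF D] in auto)
    then show ?thesis by simp
  qed
  have "(vert D d, vert D e) \<in> (adjacent D)\<^sup>*"
    using D d e by (intro adjacent_connected[OF con]) (auto simp: is_dessin_def)
  then have "\<forall>y\<in>ends D. vert D y = vert D e \<longrightarrow> Q y"
  proof induct
    case base
    then show ?case using vert d by blast
  next
    case (step u w)
    then obtain x where x: "x \<in> ends D" "u = vert D x" "w = vert D (opp D x)"
      by (auto simp: adjacent_def)
    then have "Q (opp D x)" using step opp by auto
    then have "Q y" if "y \<in> ends D" "vert D y = w" for y
      using vert[OF dessin_opp(1)[OF D x(1)] _ that(1)] that(2) x(3) by simp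
    then show ?case by blast
  qed
  then show ?thesis using e by simp
qed

text \<open>
  Edge sets are encoded by the set of ends of their edges, on which symmetric difference is the sum
  modulo 2.
\<close>

definition chains :: "('v, 'e) dessin \<Rightarrow> 'e set set" where
  "chains D = {Y. Y \<subseteq> ends D \<and> opp D ` Y \<subseteq> Y}"

definition odd_at :: "('v, 'e) dessin \<Rightarrow> 'e set \<Rightarrow> 'v \<Rightarrow> bool" where
  "odd_at D Y v \<longleftrightarrow> odd (card {d \<in> Y. vert D d = v})"

definition even_chains :: "('v, 'e) dessin \<Rightarrow> 'e set set" where
  "even_chains D = {Y \<in> chains D. \<forall>v\<in>verts D. \<not> odd_at D Y v}"

definition face_boundary :: "('v, 'e) dessin \<Rightarrow> 'e set set \<Rightarrow> 'e set" where
  "face_boundary D B = {d \<in> ends D. (face D d \<in> B) \<noteq> (face D (opp D d) \<in> B)}"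

lemma finite_chains: "is_dessin D \<Longrightarrow> finite (chains D)"
  by (rule finite_subset[of _ "Pow (ends D)"]) (auto simp: chains_def is_dessin_def)

lemma chains_sym_diff:
  assumes "is_dessin D" "Y \<in> chains D" "Z \<in> chains D"
  shows "(Y - Z) \<union> (Z - Y) \<in> chains D"
proof -
  have "opp D (opp D d) = d" if "d \<in> ends D" for d using dessin_opp(3)[OF assms(1) that] .
  then have "opp D d \<in> W \<longleftrightarrow> d \<in> W" if "W \<in> chains D" "d \<in> ends D" for d W
    using that unfolding chains_def by (metis (no_types, lifting) image_subset_iff mem_Collect_eq)
  then show ?thesis using assms(2,3) by (auto simp: chains_def)
qed

lemma odd_at_sym_diff:
  assumes "is_dessin D" "Y \<in> chains D" "Z \<in> chains D"
  shows "odd_at D ((Y - Z) \<union> (Z - Y)) v \<longleftrightarrow> odd_at D Y v \<noteq> odd_at D Z v"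
proof -
  have "finite Y" "finite Z"
    using assms by (auto simp: chains_def is_dessin_def intro: finite_subset)
  then have "odd (card (({d \<in> Y. vert D d = v} - {d \<in> Z. vert D d = v}) \<union>
      ({d \<in> Z. vert D d = v} - {d \<in> Y. vert D d = v}))) \<longleftrightarrow> odd_at D Y v \<noteq> odd_at D Z v"
    unfolding odd_at_def by (intro odd_card_sym_diff) auto
  moreover have "{d \<in> (Y - Z) \<union> (Z - Y). vert D d = v} =
      ({d \<in> Y. vert D d = v} - {d \<in> Z. vert D d = v}) \<union>
      ({d \<in> Z. vert D d = v} - {d \<in> Y. vert D d = v})" by auto
  ultimately show ?thesis by (simp add: odd_at_def)
qed

lemma card_chains:
  assumes "is_dessin D"
  shows "card (chains D) = 2 ^ card (edges D)"
proof -
  have "bij_betw Union (Pow (edges D)) (chains D)"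
  proof (rule bij_betw_byWitness[where f' = "\<lambda>Y. (\<lambda>d. {d, opp D d}) ` Y"])
    show "\<forall>F\<in>Pow (edges D). (\<lambda>d. {d, opp D d}) ` \<Union>F = F"
    proof
      fix F assume F: "F \<in> Pow (edges D)"
      show "(\<lambda>d. {d, opp D d}) ` \<Union>F = F"
      proof
        show "(\<lambda>d. {d, opp D d}) ` \<Union>F \<subseteq> F"
          using opp_mem_Union_edges(2)[OF assms] F by blast
        show "F \<subseteq> (\<lambda>d. {d, opp D d}) ` \<Union>F"
        proof
          fix e assume e: "e \<in> F"
          then obtain d where "e = {d, opp D d}" using F by (auto simp: edges_def)
          then show "e \<in> (\<lambda>d. {d, opp D d}) ` \<Union>F" using e by (intro image_eqI[of _ _ d]) auto
        qed
      qed
    qed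
    show "\<forall>Y\<in>chains D. \<Union>((\<lambda>d. {d, opp D d}) ` Y) = Y" by (auto simp: chains_def)
    show "Union ` Pow (edges D) \<subseteq> chains D"
    proof clarify
      fix F assume F: "F \<subseteq> edges D"
      show "\<Union>F \<in> chains D"
        using Union_edges_subset[OF assms F] opp_mem_Union_edges(1)[OF assms F]
        unfolding chains_def by blast
    qed
    show "(`) (\<lambda>d. {d, opp D d}) ` chains D \<subseteq> Pow (edges D)"
      by (auto simp: chains_def edges_def)
  qed
  then show ?thesis using bij_betw_same_card card_Pow[OF finite_edges[OF assms]] by metis
qed

lemma path_chain:
  assumes D: "is_dessin D" and uv: "(u, v) \<in> (adjacent D)\<^sup>*"
  shows "\<exists>Y\<in>chains D. \<forall>w. odd_at D Y w \<longleftrightarrow> (w = u) \<noteq> (w = v)"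
  using uv
proof induct
  case base
  show ?case by (rule bexI[of _ "{}"]) (auto simp: odd_at_def chains_def)
next
  case (step y z)
  then obtain Y d where Y: "Y \<in> chains D" "\<forall>w. odd_at D Y w \<longleftrightarrow> (w = u) \<noteq> (w = y)"
    and d: "d \<in> ends D" "y = vert D d" "z = vert D (opp D d)"
    by (auto simp: adjacent_def)
  note o = dessin_opp[OF D d(1)]
  have E: "{d, opp D d} \<in> chains D" using o d by (auto simp: chains_def)
  have "odd_at D {d, opp D d} w \<longleftrightarrow> (w = y) \<noteq> (w = z)" for w
  proof -
    have "{e \<in> {d, opp D d}. vert D e = w} =
        (if w = y then {d} else {}) \<union> (if w = z then {opp D d} else {})"
      using d by auto
    then show ?thesis using o(2) by (auto simp: odd_at_def)
  qed
  then show ?case using Y odd_at_sym_diff[OF D Y(1) E] chains_sym_diff[OF D Y(1) E]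
    by (intro bexI[of _ "(Y - {d, opp D d}) \<union> ({d, opp D d} - Y)"]) auto
qed

text \<open>Sums of paths from \<open>v\<^sub>0\<close> have prescribed parities at all other vertices.\<close>

lemma chain_with_parities:
  assumes D: "is_dessin D" and con: "num_components D = 1"
    and v0: "v0 \<in> verts D" and T: "T \<subseteq> verts D - {v0}"
  shows "\<exists>Y\<in>chains D. \<forall>w. w \<noteq> v0 \<longrightarrow> (odd_at D Y w \<longleftrightarrow> w \<in> T)"
proof -
  have "finite T" using T D by (auto simp: is_dessin_def intro: finite_subset)
  then show ?thesis using T
  proof induct
    case empty
    show ?case by (rule bexI[of _ "{}"]) (auto simp: odd_at_def chains_def)
  next
    case (insert t T)
    then obtain Y where Y: "Y \<in> chains D" "\<forall>w. w \<noteq> v0 \<longrightarrow> (odd_at D Y w \<longleftrightarrow> w \<in> T)" by auto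
    obtain Z where Z: "Z \<in> chains D" "\<forall>w. odd_at D Z w \<longleftrightarrow> (w = v0) \<noteq> (w = t)"
      using path_chain[OF D adjacent_connected[OF con v0]] insert.prems by blast
    show ?case
      using Y Z insert odd_at_sym_diff[OF D Y(1) Z(1)] chains_sym_diff[OF D Y(1) Z(1)]
      by (intro bexI[of _ "(Y - Z) \<union> (Z - Y)"]) auto
  qed
qed

text \<open>
  Every chain is, in a unique way, the sum of an even one and of a chosen chain realising its
  parities at the vertices other than \<open>v\<^sub>0\<close>; for the bound, uniqueness suffices.
\<close>

lemma card_even_chains_le:
  assumes D: "is_dessin D" and con: "num_components D = 1"
  shows "card (even_chains D) * 2 ^ (card (verts D) - 1) \<le> 2 ^ card (edges D)"
proof -
  have finV: "finite (verts D)" using D by (simp add: is_dessin_def)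
  have "verts D \<noteq> {}" using con by (auto simp: num_components_def)
  then obtain v0 where v0: "v0 \<in> verts D" by blast
  obtain s where s: "\<And>T. T \<subseteq> verts D - {v0} \<Longrightarrow> s T \<in> chains D"
    "\<And>T w. T \<subseteq> verts D - {v0} \<Longrightarrow> w \<noteq> v0 \<Longrightarrow> odd_at D (s T) w \<longleftrightarrow> w \<in> T"
    using chain_with_parities[OF D con v0] by metis
  define h where "h = (\<lambda>(Y, T). (Y - s T) \<union> (s T - Y))"
  have "inj_on h (even_chains D \<times> Pow (verts D - {v0}))"
  proof (rule inj_onI, clarify)
    fix Y T Y' T'
    assume Y: "Y \<in> even_chains D" "Y' \<in> even_chains D"
      and T: "T \<subseteq> verts D - {v0}" "T' \<subseteq> verts D - {v0}" and eq: "h (Y, T) = h (Y', T')"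
    have ch: "Y \<in> chains D" "Y' \<in> chains D" using Y by (auto simp: even_chains_def)
    have "w \<in> T \<longleftrightarrow> w \<in> T'" if w: "w \<in> verts D - {v0}" for w
    proof -
      have "odd_at D (h (Y, T)) w \<longleftrightarrow> w \<in> T"
        using w Y T odd_at_sym_diff[OF D ch(1) s(1)[OF T(1)]] s(2)[OF T(1)]
        by (auto simp: h_def even_chains_def)
      moreover have "odd_at D (h (Y', T')) w \<longleftrightarrow> w \<in> T'"
        using w Y T odd_at_sym_diff[OF D ch(2) s(1)[OF T(2)]] s(2)[OF T(2)]
        by (auto simp: h_def even_chains_def)
      ultimately show ?thesis using eq by simp
    qed
    then have TT: "T = T'" using T by blast
    moreover have "Y = Y'" using eq unfolding TT h_def by auto
    ultimately show "Y = Y' \<and> T = T'" by simp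
  qed
  then have "card (even_chains D \<times> Pow (verts D - {v0})) \<le> card (chains D)"
    using s(1) by (intro card_inj_on_le[of h] finite_chains[OF D])
      (auto simp: h_def even_chains_def intro!: chains_sym_diff[OF D])
  then show ?thesis
    using v0 finV by (simp add: card_cartesian_product card_Pow card_chains[OF D])
qed

text \<open>
  Around a vertex the face on one side of an end is the face on the other side of the next one, so
  membership in \<open>B\<close> changes an even number of times.
\<close>

lemma face_boundary_even:
  assumes D: "is_dessin D"
  shows "face_boundary D B \<in> even_chains D"
proof -
  have fin: "finite (ends D)" using D by (simp add: is_dessin_def)
  have "\<not> odd_at D (face_boundary D B) v" for v
  proof -
    define S where "S = {d \<in> ends D. vert D d = v}"
    define A where "A = {d \<in> S. face D d \<in> B}"
    define A' where "A' = {d \<in> S. face D (nxt D d) \<in> B}"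
    have bij: "bij_betw (nxt D) (ends D) (ends D)" by (rule dessin_bij_nxt[OF D])
    have "nxt D ` A' = A"
    proof
      show "nxt D ` A' \<subseteq> A" using dessin_nxt_closed[OF D] by (auto simp: A_def A'_def S_def)
      show "A \<subseteq> nxt D ` A'"
      proof
        fix y assume y: "y \<in> A"
        then have "y \<in> nxt D ` ends D" using bij by (simp add: A_def S_def bij_betw_def)
        then obtain x where "x \<in> ends D" "y = nxt D x" by blast
        then show "y \<in> nxt D ` A'" using y dessin_nxt_closed[OF D, of x]
          by (auto simp: A_def A'_def S_def)
      qed
    qed
    moreover have "inj_on (nxt D) A'"
      using bij by (rule inj_on_subset[OF bij_betw_imp_inj_on]) (auto simp: A'_def S_def)
    ultimately have "card A = card A'" using card_image by blast
    moreover have "{d \<in> face_boundary D B. vert D d = v} = (A - A') \<union> (A' - A)"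
      using face_nxt[OF D] by (auto simp: face_boundary_def A_def A'_def S_def)
    moreover have "finite A" "finite A'" using fin by (auto simp: A_def A'_def S_def)
    ultimately show ?thesis using odd_card_sym_diff[of A A'] by (simp add: odd_at_def)
  qed
  moreover have "face_boundary D B \<in> chains D"
    using dessin_opp[OF D] by (auto simp: chains_def face_boundary_def)
  ultimately show ?thesis by (simp add: even_chains_def)
qed

lemma inj_on_face_boundary:
  assumes D: "is_dessin D" and con: "num_components D = 1" and d0: "d0 \<in> ends D"
  shows "inj_on (face_boundary D) (Pow (face D ` ends D - {face D d0}))"
proof (rule inj_onI)
  fix B B' assume B: "B \<in> Pow (face D ` ends D - {face D d0})"
      "B' \<in> Pow (face D ` ends D - {face D d0})" and eq: "face_boundary D B = face_boundary D B'"
  define Q where "Q = (\<lambda>d. face D d \<in> B \<longleftrightarrow> face D d \<in> B')"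
  have opp: "Q (opp D d)" if "d \<in> ends D" "Q d" for d
    using that eq by (auto simp: face_boundary_def Q_def)
  have "Q e" if e: "e \<in> ends D" for e
  proof (rule connected_ends_induct[where Q = Q, OF D con])
    show "Q (nxt D d)" if "d \<in> ends D" "Q d" for d
      using opp[OF that] face_nxt[OF D that(1)] by (simp add: Q_def)
    show "Q d0" using B by (auto simp: Q_def)
  qed (use opp d0 e in auto)
  then show "B = B'" using B by (auto simp: Q_def)
qed

text \<open>
  Simple connectedness of the sphere, for homology modulo 2: by Euler's formula there are as many
  boundaries of sets of faces as there can be even chains at most.
\<close>

theorem spherical_even_chain_bounds:
  assumes D: "is_dessin D" and con: "num_components D = 1" and genus: "genus D = 0"
    and "verts D = vert D ` ends D" and Y: "Y \<in> even_chains D"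
  obtains B where "Y = face_boundary D B"
proof -
  have fin: "finite (ends D)" "finite (verts D)" using D by (auto simp: is_dessin_def)
  have ne: "verts D \<noteq> {}" using con by (auto simp: num_components_def)
  then obtain d0 where d0: "d0 \<in> ends D" using assms(4) by auto
  define f where "f = card (face D ` ends D)"
  have f: "num_faces D = f" using assms(4) by (simp add: num_faces_def f_def)
  have "f \<noteq> 0" using d0 fin by (auto simp: f_def)
  have "(of_nat (card (verts D) + f) :: rat) = of_nat (card (edges D) + 2)"
    using genus con by (simp add: genus_def f)
  then have "card (verts D) + f = card (edges D) + 2" using of_nat_eq_iff by blast
  moreover have "card (verts D) \<noteq> 0" using ne fin by simp
  ultimately have "card (edges D) = (f - 1) + (card (verts D) - 1)" using \<open>f \<noteq> 0\<close> by arith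
  then have "card (even_chains D) \<le> 2 ^ (f - 1)"
    using card_even_chains_le[OF D con] by (simp add: power_add)
  moreover have "card (face_boundary D ` Pow (face D ` ends D - {face D d0})) = 2 ^ (f - 1)"
    using card_image[OF inj_on_face_boundary[OF D con d0]] fin d0 by (simp add: card_Pow f_def)
  moreover have "face_boundary D ` Pow (face D ` ends D - {face D d0}) \<subseteq> even_chains D"
    using face_boundary_even[OF D] by auto
  moreover have "finite (even_chains D)" using finite_chains[OF D] by (simp add: even_chains_def)
  ultimately have "face_boundary D ` Pow (face D ` ends D - {face D d0}) = even_chains D"
    by (intro card_seteq) auto
  then show ?thesis using Y that by blast
qed


section \<open>State circles of a connected projection\<close>

lemma four_arith [simp]:
  "(4::4) = 0" "(5::4) = 1" "- (1::4) = 3"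
  "(0::4) \<noteq> 2" "(0::4) \<noteq> 3" "(1::4) \<noteq> 2" "(1::4) \<noteq> 3" "(2::4) \<noteq> 3"
  "(2::4) \<noteq> 0" "(3::4) \<noteq> 0" "(2::4) \<noteq> 1" "(3::4) \<noteq> 1" "(3::4) \<noteq> 2"
  by simp_all

lemma four_cases:
  fixes i :: 4
  obtains "i = 0" | "i = 1" | "i = 2" | "i = 3"
  using exhaust_4[of i] by auto

locale crossed_projection =
  fixes P :: "'c projection"
  assumes proj: "connected_projection P" and crossed: "crossings P \<noteq> {}"
begin

abbreviation M :: "('c, 'c dart) dessin" where "M \<equiv> plane_map P"

lemma M_simps [simp]:
  "verts M = crossings P" "ends M = darts P" "vert M = fst" "opp M = glue P" "nxt M (c, i) = (c, i + 1)"
  by (auto simp: plane_map_def)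

lemma dessin_M: "is_dessin M" and genus_M: "genus M = 0" and connected_M: "num_components M = 1"
  and outer_dart: "outer P \<in> darts P"
  using proj crossed by (auto simp: connected_projection_def)

lemma finite_darts: "finite (darts P)"
  using dessin_M by (simp add: is_dessin_def)

lemma dart_iff [simp]: "(c, i) \<in> darts P \<longleftrightarrow> c \<in> crossings P"
  by (simp add: darts_def)

lemma glue_dart [simp]: "d \<in> darts P \<Longrightarrow> glue P d \<in> darts P" "d \<in> darts P \<Longrightarrow> glue P (glue P d) = d"
  using dessin_opp[OF dessin_M] by auto

lemma region_succ: "c \<in> crossings P \<Longrightarrow> region P (c, i + 1) = region P (glue P (c, i))"
  using face_nxt[OF dessin_M, of "(c, i)"] by simp

lemma region_glue:
  assumes "c \<in> crossings P"
  shows "region P (glue P (c, 0)) = region P (c, 1)" "region P (glue P (c, 1)) = region P (c, 2)"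
    "region P (glue P (c, 2)) = region P (c, 3)" "region P (glue P (c, 3)) = region P (c, 0)"
  using region_succ[OF assms, of 0] region_succ[OF assms, of 1] region_succ[OF assms, of 2]
    region_succ[OF assms, of 3] by simp_all

lemma splice_dart [simp]: "d \<in> darts P \<Longrightarrow> splice S d \<in> darts P" "splice S (splice S d) = d"
proof -
  obtain c i where d: "d = (c, i)" by (cases d)
  show "d \<in> darts P \<Longrightarrow> splice S d \<in> darts P" by (auto simp: splice_def d)
  show "splice S (splice S d) = d"
    by (cases i rule: four_cases) (auto simp: splice_def d)
qed

definition circle_step :: "'c set \<Rightarrow> ('c dart \<times> 'c dart) set" where
  "circle_step S = {(d, glue P d) | d. d \<in> darts P} \<union> {(d, splice S d) | d. d \<in> darts P}"

lemma circle_eq: "circle P S d = (circle_step S)\<^sup>* `` {d}"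
  by (simp add: circle_def circle_step_def)

lemma circle_step_glue: "d \<in> darts P \<Longrightarrow> (d, glue P d) \<in> circle_step S"
  unfolding circle_step_def by blast

lemma circle_step_splice: "d \<in> darts P \<Longrightarrow> (d, splice S d) \<in> circle_step S"
  unfolding circle_step_def by blast

lemma circle_step_cases:
  assumes "(d, e) \<in> circle_step S"
  obtains "d \<in> darts P" "e = glue P d" | "d \<in> darts P" "e = splice S d"
  using assms unfolding circle_step_def by blast

lemma sym_circle_step: "sym (circle_step S)"
proof (rule symI)
  fix d e assume "(d, e) \<in> circle_step S"
  then show "(e, d) \<in> circle_step S"
    using circle_step_glue[of e S] circle_step_splice[of e S] by (cases rule: circle_step_cases) auto
qed

lemma circle_eqI: "e \<in> circle P S d \<Longrightarrow> circle P S e = circle P S d"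
  unfolding circle_eq using sym_rtrancl[OF sym_circle_step, of S]
  by (auto dest: symD intro: rtrancl_trans)

lemma circle_self [simp]: "d \<in> circle P S d"
  by (simp add: circle_eq)

lemma circle_induct [consumes 2, case_names start glue splice]:
  assumes "e \<in> circle P S d" "d \<in> darts P" "Q d"
    and "\<And>e. e \<in> darts P \<Longrightarrow> e \<in> circle P S d \<Longrightarrow> Q e \<Longrightarrow> Q (glue P e)"
    and "\<And>e. e \<in> darts P \<Longrightarrow> e \<in> circle P S d \<Longrightarrow> Q e \<Longrightarrow> Q (splice S e)"
  shows "Q e"
proof -
  have "(d, e) \<in> (circle_step S)\<^sup>*" using assms(1) by (simp add: circle_eq)
  then show ?thesis
  proof induct
    case (step e f)
    have "e \<in> circle P S d" using step(1) by (simp add: circle_eq)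
    with step(2,3) show ?case by (cases rule: circle_step_cases) (auto intro: assms(4,5))
  qed (rule assms(3))
qed

lemma circle_subset:
  assumes "d \<in> darts P"
  shows "circle P S d \<subseteq> darts P"
proof
  fix e assume "e \<in> circle P S d"
  from this assms show "e \<in> darts P" by (induct rule: circle_induct) (auto intro: assms)
qed

lemma circle_glue: "d \<in> darts P \<Longrightarrow> circle P S (glue P d) = circle P S d"
  by (intro circle_eqI) (simp add: circle_eq r_into_rtrancl circle_step_glue)

lemma circle_splice: "d \<in> darts P \<Longrightarrow> circle P S (splice S d) = circle P S d"
  by (intro circle_eqI) (simp add: circle_eq r_into_rtrancl circle_step_splice)

lemma mem_circle_iff: "e \<in> circle P S d \<longleftrightarrow> circle P S e = circle P S d"
  using circle_eqI circle_self by metis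

lemma circles_eq: "circles P S = circle P S ` darts P"
  using crossed by (simp add: circles_def)

lemma finite_circles: "finite (circles P S)"
  using finite_darts by (simp add: circles_eq)

lemma mem_circles_iff:
  assumes "X \<in> circles P S" "d \<in> darts P"
  shows "d \<in> X \<longleftrightarrow> X = circle P S d"
proof -
  obtain e where "X = circle P S e" using assms(1) by (auto simp: circles_eq)
  then show ?thesis using mem_circle_iff[of d S e] by auto
qed

lemma circlesD:
  assumes "X \<in> circles P S" "d \<in> X"
  shows "d \<in> darts P" "X = circle P S d"
proof -
  obtain e where "e \<in> darts P" "X = circle P S e" using assms(1) by (auto simp: circles_eq)
  then show "d \<in> darts P" using circle_subset assms(2) by blast
  then show "X = circle P S d" using mem_circles_iff assms by blast
qed


section \<open>The Jordan curve theorem for circles of the all-A state\<close>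

abbreviation connects :: "'c dart set \<Rightarrow> 'c dart \<Rightarrow> 'c dart \<Rightarrow> bool" where
  "connects X d e \<equiv> (region P d, region P e) \<in> (region_step P X)\<^sup>*"

lemma region_step_glue:
  "d \<in> darts P - X \<Longrightarrow> (region P d, region P (glue P d)) \<in> region_step P X"
  unfolding region_step_def by blast

lemma region_step_corners:
  assumes "c \<in> crossings P"
  shows "(region P (c, 0), region P (c, 2)) \<in> region_step P X"
    "(region P (c, 2), region P (c, 0)) \<in> region_step P X"
proof -
  have "(region P (c, i), region P (c, i + 2)) \<in> region_step P X" if "i \<in> {0, 2}" for i
    using assms that unfolding region_step_def by blast
  from this[of 0] this[of 2] show "(region P (c, 0), region P (c, 2)) \<in> region_step P X"
    "(region P (c, 2), region P (c, 0)) \<in> region_step P X" by simp_all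
qed

lemma region_step_cases:
  assumes "(R, R') \<in> region_step P X"
  obtains d where "d \<in> darts P - X" "R = region P d" "R' = region P (glue P d)"
    | c where "c \<in> crossings P" "R = region P (c, 0)" "R' = region P (c, 2)"
    | c where "c \<in> crossings P" "R = region P (c, 2)" "R' = region P (c, 0)"
proof -
  from assms consider d where "d \<in> darts P - X" "R = region P d" "R' = region P (glue P d)"
    | c i where "c \<in> crossings P" "i \<in> {0, 2}" "R = region P (c, i)" "R' = region P (c, i + 2)"
    unfolding region_step_def by blast
  then show ?thesis
  proof cases
    case (2 c i)
    then show ?thesis using that(2,3)[of c] by auto
  qed (rule that(1))
qed

lemma sym_region_step:
  assumes "glue P ` X \<subseteq> X"
  shows "sym (region_step P X)"
proof (rule symI)
  fix R R' assume "(R, R') \<in> region_step P X"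
  then show "(R', R) \<in> region_step P X"
  proof (cases rule: region_step_cases)
    case (1 d)
    have "glue P d \<notin> X"
    proof
      assume "glue P d \<in> X"
      then have "glue P (glue P d) \<in> X" using assms by blast
      then show False using 1 by simp
    qed
    then show ?thesis using 1 region_step_glue[of "glue P d" X] by simp
  qed (auto intro: region_step_corners)
qed

lemma connects_sym: "glue P ` X \<subseteq> X \<Longrightarrow> connects X d e \<Longrightarrow> connects X e d"
  using sym_rtrancl[OF sym_region_step] by (auto dest: symD)

lemma connects_glue: "d \<in> darts P - X \<Longrightarrow> connects X d (glue P d)"
  using region_step_glue by blast

text \<open>
  The edge-ends \<open>d\<close> and \<open>splice {} d\<close> lie on one strand but are directed oppositely along it, so the
  right-hand side of the one continues the left-hand side of the other.
\<close>

lemma connects_splice: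
  assumes d: "d \<in> darts P"
  shows "connects X (glue P d) (splice {} d)" "connects X d (glue P (splice {} d))"
proof -
  obtain c i where c: "d = (c, i)" "c \<in> crossings P" using d by (cases d) auto
  have "connects X (c, 0) (c, 2)" "connects X (c, 2) (c, 0)"
    using region_step_corners[OF c(2)] by auto
  then show "connects X (glue P d) (splice {} d)" "connects X d (glue P (splice {} d))"
    using c region_glue[OF c(2)]
    by (cases i rule: four_cases; simp add: splice_def)+
qed

context
  fixes X assumes X: "X \<in> A_circles P"
begin

lemma A_circle_subset: "X \<subseteq> darts P"
  using X circle_subset by (auto simp: circles_eq)

lemma A_circle_glue: "glue P ` X \<subseteq> X"
proof
  fix e assume "e \<in> glue P ` X"
  then obtain d where d: "d \<in> X" "e = glue P d" by blast
  then show "e \<in> X"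
    using mem_circles_iff[OF X, of d] mem_circles_iff[OF X, of e] A_circle_subset circle_glue[of d]
    by auto
qed

lemma A_circle_strand:
  assumes "c \<in> crossings P"
  shows "(c, 0) \<in> X \<longleftrightarrow> (c, 1) \<in> X" "(c, 2) \<in> X \<longleftrightarrow> (c, 3) \<in> X"
  using assms circle_splice[of "(c, 0)" "{}"] circle_splice[of "(c, 2)" "{}"]
    mem_circles_iff[OF X] by (auto simp: splice_def)

lemma A_circle_even: "X \<in> even_chains M"
proof -
  have "\<not> odd_at M X c" if c: "c \<in> crossings P" for c
  proof -
    have "{d \<in> X. fst d = c} = (if (c, 0) \<in> X then {(c, 0), (c, 1)} else {}) \<union>
        (if (c, 2) \<in> X then {(c, 2), (c, 3)} else {})"
      (is "?L = ?R")
    proof (rule set_eqI)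
      fix d :: "'c dart"
      obtain c' i where d: "d = (c', i)" by (cases d)
      show "d \<in> ?L \<longleftrightarrow> d \<in> ?R"
        using A_circle_strand[OF c] by (cases i rule: four_cases) (auto simp: d)
    qed
    moreover have "even (card ?R)" by simp
    ultimately show ?thesis by (simp add: odd_at_def)
  qed
  then show ?thesis
    using A_circle_subset A_circle_glue by (auto simp: even_chains_def chains_def)
qed

text \<open>
  Colour the regions by a set of which the circle is the boundary. The colour changes across the edges
  of the circle only, and it agrees on the two corners joined at a crossing, because the two ends of a
  strand are both on the circle or both off it.
\<close>

lemma A_circle_separates:
  assumes d: "d \<in> X"
  shows "\<not> connects X d (glue P d)"
proof -
  have "verts M = vert M ` ends M" by (force simp: darts_def)
  from spherical_even_chain_bounds[OF dessin_M connected_M genus_M this A_circle_even]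
  obtain B where "X = face_boundary M B" .
  then have B: "d \<in> X \<longleftrightarrow> (region P d \<in> B) \<noteq> (region P (glue P d) \<in> B)" if "d \<in> darts P" for d
    using that by (simp add: face_boundary_def)
  have step: "R \<in> B \<longleftrightarrow> R' \<in> B" if "(R, R') \<in> region_step P X" for R R'
  proof -
    have corner: "region P (c, 0) \<in> B \<longleftrightarrow> region P (c, 2) \<in> B" if c: "c \<in> crossings P" for c
      using B[of "(c, 0)"] B[of "(c, 1)"] c region_glue[OF c] A_circle_strand[OF c] by auto
    show ?thesis
      using that by (cases rule: region_step_cases) (use B corner in auto)
  qed
  have "R \<in> B \<longleftrightarrow> R' \<in> B" if "(R, R') \<in> (region_step P X)\<^sup>*" for R R'
    using that by induct (auto simp: step)
  then show ?thesis using B d A_circle_subset by blast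
qed

text \<open>
  Walking along the circle, one stays next to the regions on both sides of \<open>d\<close>; hence crossing the
  circle anywhere leads from the one side to the other.
\<close>

lemma A_circle_sides:
  assumes d: "d \<in> X" and e: "e \<in> X"
  shows "connects X e d \<and> connects X (glue P e) (glue P d) \<or>
    connects X e (glue P d) \<and> connects X (glue P e) d"
proof -
  have "e \<in> A_circle P d" "d \<in> darts P" using d e X mem_circles_iff A_circle_subset by blast+
  then show ?thesis
  proof (induct rule: circle_induct)
    case (splice e)
    have "connects X (splice {} e) (glue P e)" "connects X (glue P (splice {} e)) e"
      using connects_sym[OF A_circle_glue] connects_splice[OF splice(1), of X] by auto
    then show ?case using splice(3) by (meson rtrancl_trans)
  qed auto
qed

lemma A_circle_two_sides:
  assumes d: "d \<in> X" and e: "e \<in> darts P"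
  shows "connects X e d \<or> connects X e (glue P d)"
proof -
  define Q where "Q = (\<lambda>e. connects X e d \<or> connects X e (glue P d))"
  have glue: "Q (glue P e)" if e: "e \<in> darts P" "Q e" for e
  proof (cases "e \<in> X")
    case True
    then show ?thesis using A_circle_sides[OF d True] by (auto simp: Q_def)
  next
    case False
    have "connects X (glue P e) e"
      using connects_sym[OF A_circle_glue connects_glue] e(1) False by auto
    then show ?thesis using e(2) unfolding Q_def by (meson rtrancl_trans)
  qed
  have "Q e"
  proof (rule connected_ends_induct[where Q = Q, OF dessin_M connected_M])
    show "Q (nxt M e)" if "e \<in> ends M" "Q e" for e
    proof -
      have "region P (nxt M e) = region P (glue P e)"
        using face_nxt[OF dessin_M that(1)] by simp
      then show ?thesis using glue[of e] that by (simp add: Q_def)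
    qed
    show "Q d" by (simp add: Q_def)
  qed (use glue d e A_circle_subset in auto)
  then show ?thesis by (simp add: Q_def)
qed

lemma inside_A_circle_cong:
  assumes "connects X d e"
  shows "inside_circle P X (region P d) \<longleftrightarrow> inside_circle P X (region P e)"
  using assms connects_sym[OF A_circle_glue assms] unfolding inside_circle_def
  by (meson rtrancl_trans)

theorem A_circle_Jordan:
  assumes d: "d \<in> darts P"
  shows "inside_circle P X (region P d) \<noteq> inside_circle P X (region P (glue P d)) \<longleftrightarrow> d \<in> X"
proof (cases "d \<in> X")
  case True
  have "connects X (outer P) d \<or> connects X (outer P) (glue P d)"
    using A_circle_two_sides[OF True outer_dart] .
  moreover have "\<not> (connects X (outer P) d \<and> connects X (outer P) (glue P d))"
    using A_circle_separates[OF True] connects_sym[OF A_circle_glue] by (meson rtrancl_trans)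
  ultimately show ?thesis using True by (auto simp: inside_circle_def)
next
  case False
  then show ?thesis using inside_A_circle_cong[OF connects_glue] d by auto
qed

text \<open>
  Different circles are disjoint, so walking along \<open>Y\<close> one never changes sides of \<open>X\<close>. Hence the depth
  of a circle can be read off at any of its edges, and on either side of it.
\<close>

lemma inside_A_circle_along:
  assumes Y: "Y \<in> A_circles P" "Y \<noteq> X" and d: "d \<in> Y" and e: "e \<in> Y"
  shows "inside_circle P X (region P e) \<longleftrightarrow> inside_circle P X (region P d)"
proof -
  have Yd: "Y = A_circle P d" "d \<in> darts P"
    using circlesD[OF Y(1) d] by auto
  have off: "e \<notin> X" if "e \<in> darts P" "e \<in> A_circle P d" for e
    using that Yd Y mem_circles_iff[OF X] mem_circles_iff[OF Y(1)] by auto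
  from e show ?thesis using Yd(2) unfolding Yd(1)
  proof (induct rule: circle_induct)
    case (glue e)
    then show ?case using A_circle_Jordan[of e] off by auto
  next
    case (splice e)
    then show ?case
      using A_circle_Jordan[of e] off inside_A_circle_cong[OF connects_splice(1)[of e X]] by auto
  qed simp
qed

end


section \<open>The orientation of the circles is the checkerboard orientation\<close>

definition num_around :: "'c dart set \<Rightarrow> nat" where
  "num_around R = card {X \<in> A_circles P. inside_circle P X R}"

text \<open>By the Jordan curve theorem only the circle through \<open>d\<close> separates the two sides of \<open>d\<close>.\<close>

lemma odd_num_around_glue:
  assumes d: "d \<in> darts P"
  shows "odd (num_around (region P (glue P d))) \<longleftrightarrow> even (num_around (region P d))"
proof -
  let ?A = "{X \<in> A_circles P. inside_circle P X (region P d)}"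
  let ?B = "{X \<in> A_circles P. inside_circle P X (region P (glue P d))}"
  have "(?A - ?B) \<union> (?B - ?A) = {X \<in> A_circles P. d \<in> X}"
    using A_circle_Jordan[OF _ d] by auto
  also have "\<dots> = {A_circle P d}"
    using d mem_circles_iff[OF _ d] by (auto simp: circles_eq)
  finally have "odd (card ((?A - ?B) \<union> (?B - ?A)))" by simp
  then show ?thesis
    using odd_card_sym_diff[of ?A ?B] finite_circles by (simp add: num_around_def)
qed

text \<open>
  The circles around the left-hand side of \<open>d\<close> are those around the circle \<open>Y\<close> through \<open>d\<close> and possibly
  \<open>Y\<close> itself. In either case the definition of the orientation makes \<open>d\<close> forward if their number is
  odd.
\<close>

lemma forward_iff:
  assumes d: "d \<in> darts P"
  shows "forward P d \<longleftrightarrow> odd (num_around (region P (glue P d)))"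
proof -
  define Y where "Y = A_circle P d"
  have Y: "Y \<in> A_circles P" "d \<in> Y" "glue P d \<in> Y"
    using d circle_glue[OF d] by (auto simp: Y_def circles_eq mem_circle_iff)
  define N where "N = {X \<in> A_circles P. inside_circle P X (region P (glue P d))}"
  have "{X \<in> A_circles P. X \<noteq> Y \<and> (\<forall>e\<in>Y. inside_circle P X (region P e))} = N - {Y}"
    using inside_A_circle_along[OF _ Y(1) _ Y(3)] Y(3) by (auto simp: N_def)
  then have "depth P Y = card (N - {Y})" by (simp add: depth_def)
  moreover have "finite N" using finite_circles[of "{}"] by (simp add: N_def)
  ultimately have "card N = depth P Y + (if Y \<in> N then 1 else 0)"
    using card.remove[of N Y] by auto
  moreover have "forward P d \<longleftrightarrow> (Y \<in> N \<longleftrightarrow> even (depth P Y))"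
    using Y by (simp add: forward_def N_def flip: Y_def)
  moreover have "num_around (region P (glue P d)) = card N" by (simp add: num_around_def N_def)
  ultimately show ?thesis by simp
qed

lemma forward_glue: "d \<in> darts P \<Longrightarrow> forward P (glue P d) \<longleftrightarrow> \<not> forward P d"
  using odd_num_around_glue[of d] by (simp add: forward_iff)

lemma forward_succ:
  assumes c: "c \<in> crossings P"
  shows "forward P (c, i + 1) \<longleftrightarrow> \<not> forward P (c, i)"
  using c odd_num_around_glue[of "(c, i + 1)"] region_succ[OF c, of i] by (simp add: forward_iff)

lemma forward_ends:
  assumes "c \<in> crossings P"
  shows "forward P (c, 1) \<longleftrightarrow> \<not> forward P (c, 0)" "forward P (c, 2) \<longleftrightarrow> forward P (c, 0)"
    "forward P (c, 3) \<longleftrightarrow> \<not> forward P (c, 0)"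
  using forward_succ[OF assms, of 0] forward_succ[OF assms, of 1] forward_succ[OF assms, of 2] by auto

lemma forward_splice:
  assumes "d \<in> darts P"
  shows "forward P (splice S d) \<longleftrightarrow> \<not> forward P d"
proof -
  obtain c i where c: "d = (c, i)" "c \<in> crossings P" using assms by (cases d) auto
  then show ?thesis
    using forward_ends[OF c(2)] by (cases i rule: four_cases) (auto simp: splice_def)
qed

end


section \<open>State circles are faces of spanning sub-dessins\<close>

lemma orbit_image:
  assumes "bij_betw f A A" "finite A" "\<And>x. x \<in> A \<Longrightarrow> h (f x) = g (h x)" "x \<in> A"
  shows "orbit g (h x) = h ` orbit f x"
proof -
  have "g (h y) = h (f y)" if "y \<in> orbit f x" for y
    using assms(3)[of y] orbit_subset_bij[OF assms(1,4)] that by auto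
  then show ?thesis
    using orbit_inverse[OF self_in_orbit_bij[OF assms(2,1,4)], of g h] by simp
qed

lemma num_orbits_image:
  assumes "bij_betw f A A" "finite A" "\<And>x. x \<in> A \<Longrightarrow> h (f x) = g (h x)" "inj_on h A"
  shows "num_orbits g (h ` A) = num_orbits f A"
proof -
  have "orbit g ` h ` A = (`) h ` orbit f ` A"
    using orbit_image[of f A h g] assms(1-3) by (auto simp: image_image)
  moreover have "inj_on ((`) h) (orbit f ` A)"
    using assms(4) orbit_subset_bij[OF assms(1)]
    by (intro inj_on_subset[OF inj_on_image_Pow]) auto
  ultimately show ?thesis by (simp add: num_orbits_def card_image)
qed

definition arc_edges :: "'c set \<Rightarrow> 'c dart set set" where
  "arc_edges S = (\<lambda>c. {(c, 0), (c, 2)}) ` S"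

lemma Union_arc_edges: "(c, i) \<in> \<Union>(arc_edges S) \<longleftrightarrow> c \<in> S \<and> (i = 0 \<or> i = 2)"
  by (auto simp: arc_edges_def)

lemma inj_arc_edge: "inj_on (\<lambda>c. {(c, 0), (c, 2)} :: 'c dart set) S"
  by (rule inj_onI) (auto simp: doubleton_eq_iff)

lemma all_A_dessin_simps:
  "verts (all_A_dessin P) = A_circles P" "ends (all_A_dessin P) = crossings P \<times> {0, 2}"
  "vert (all_A_dessin P) = A_circle P" "opp (all_A_dessin P) (c, i) = (c, i + 2)"
  "nxt (all_A_dessin P) (c, i) =
    arc_end_of (glue P (THE d. d \<in> {(c, i), (c, i + 1)} \<and> forward P d))"
  by (simp_all add: all_A_dessin_def)

lemma opp_on_arc_edges:
  "opp_on (all_A_dessin P) (arc_edges S) (c, i) =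
    (c, if c \<in> S \<and> (i = 0 \<or> i = 2) then i + 2 else i)"
  unfolding opp_on_def Union_arc_edges by (simp add: all_A_dessin_simps)

lemma edges_all_A_dessin: "edges (all_A_dessin P) = arc_edges (crossings P)"
proof -
  have eq: "{(c, i), opp (all_A_dessin P) (c, i)} = {(c, 0), (c, 2)}" if "i = 0 \<or> i = 2" for c i
    using that by (auto simp: all_A_dessin_simps)
  have "edges (all_A_dessin P) =
      (\<lambda>(c, i). {(c, 0), (c, 2)}) ` (crossings P \<times> ({0, 2} :: 4 set))"
    unfolding edges_def all_A_dessin_simps(2) 
  proof (rule image_cong[OF refl])
    fix x assume "x \<in> crossings P \<times> {0, 2 :: 4}"
    then show "{x, opp (all_A_dessin P) x} = (case x of (c, i) \<Rightarrow> {(c, 0), (c, 2)})"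
      using eq[of "snd x" "fst x"] by (cases x) simp
  qed
  then show ?thesis by (auto simp: arc_edges_def)
qed

context crossed_projection
begin

abbreviation D :: "('c dart set, 'c dart) dessin" where "D \<equiv> all_A_dessin P"

definition incoming :: "'c dart set" where
  "incoming = {d \<in> darts P. \<not> forward P d}"

text \<open>
  Every splicing joins an incoming to an outgoing edge-end. Walking along the oriented circles of the
  state \<open>S\<close>, one therefore meets the incoming edge-ends in the order given by this permutation.
\<close>

definition state_walk :: "'c set \<Rightarrow> 'c dart \<Rightarrow> 'c dart" where
  "state_walk S = glue P \<circ> splice S"

lemma finite_incoming: "finite incoming"
  using finite_darts by (simp add: incoming_def)

lemma bij_state_walk: "bij_betw (state_walk S) incoming incoming"
proof -
  have closed: "state_walk S ` incoming \<subseteq> incoming"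
    by (auto simp: incoming_def state_walk_def forward_glue forward_splice simp del: dart_iff
        simp flip: split_paired_All)
  moreover have "inj_on (state_walk S) incoming"
  proof (rule inj_onI)
    fix d e assume "d \<in> incoming" "e \<in> incoming" "state_walk S d = state_walk S e"
    then have "splice S (glue P (state_walk S d)) = splice S (glue P (state_walk S e))"
      "d \<in> darts P" "e \<in> darts P" by (auto simp: incoming_def)
    then show "d = e" by (simp add: state_walk_def)
  qed
  ultimately show ?thesis
    using finite_incoming by (simp add: bij_betw_def endo_inj_surj)
qed

lemma circle_incoming:
  assumes d: "d \<in> incoming"
  shows "circle P S d \<inter> incoming = orbit (state_walk S) d"
proof
  note bij = bij_state_walk[of S] and fin = finite_incoming
  have dD: "d \<in> darts P" using d by (simp add: incoming_def)
  show "orbit (state_walk S) d \<subseteq> circle P S d \<inter> incoming"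
  proof
    fix e assume e: "e \<in> orbit (state_walk S) d"
    then have "e \<in> circle P S d"
    proof induct
      case base
      then show ?case using dD
        by (simp add: state_walk_def mem_circle_iff circle_glue circle_splice)
    next
      case (step e)
      then have "e \<in> darts P" using circle_subset[OF dD] by blast
      then show ?case using step
        by (simp add: state_walk_def mem_circle_iff circle_glue circle_splice)
    qed
    then show "e \<in> circle P S d \<inter> incoming" using e orbit_subset_bij[OF bij d] by auto
  qed
  \<comment> \<open>An outgoing end of the circle is accounted for by the incoming end that follows it.\<close>
  have "(if forward P e then glue P e else e) \<in> orbit (state_walk S) d" if "e \<in> circle P S d" for e
    using that dD
  proof (induct rule: circle_induct)
    case start
    then show ?case using d self_in_orbit_bij[OF fin bij d] by (simp add: incoming_def)
  next
    case (glue e)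
    then show ?case by (auto simp: forward_glue split: if_splits)
  next
    case (splice e)
    show ?case
    proof (cases "forward P e")
      case True
      then have inc: "splice S e \<in> incoming"
        using splice(1) by (simp add: incoming_def forward_splice)
      have "glue P e = state_walk S (splice S e)" by (simp add: state_walk_def)
      then show ?thesis
        using splice True orbit_step_iff_bij[OF fin bij d inc] by (simp add: forward_splice)
    next
      case False
      then have "state_walk S e \<in> orbit (state_walk S) d"
        using splice(3) by (auto intro: orbit.step)
      moreover have "state_walk S e = glue P (splice S e)" by (simp add: state_walk_def)
      ultimately show ?thesis using splice(1) False by (simp add: forward_splice)
    qed
  qed
  then show "circle P S d \<inter> incoming \<subseteq> orbit (state_walk S) d"
    by (force simp: incoming_def)
qed

lemma card_circles: "card (circles P S) = num_orbits (state_walk S) incoming"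
proof -
  have "circles P S = circle P S ` incoming"
  proof
    show "circle P S ` incoming \<subseteq> circles P S" by (auto simp: circles_eq incoming_def)
    show "circles P S \<subseteq> circle P S ` incoming"
    proof
      fix X assume "X \<in> circles P S"
      then obtain d where d: "d \<in> darts P" "X = circle P S d" by (auto simp: circles_eq)
      define e where "e = (if forward P d then glue P d else d)"
      have "e \<in> incoming" "X = circle P S e"
        using d by (auto simp: e_def incoming_def forward_glue circle_glue)
      then show "X \<in> circle P S ` incoming" by blast
    qed
  qed
  moreover have "inj_on (\<lambda>X. X \<inter> incoming) (circle P S ` incoming)"
  proof (rule inj_onI, clarify)
    fix d e assume *: "d \<in> incoming" "e \<in> incoming"
      "circle P S d \<inter> incoming = circle P S e \<inter> incoming"
    then have "d \<in> circle P S e" using circle_self[of d S] by blast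
    then show "circle P S d = circle P S e" by (rule circle_eqI)
  qed
  moreover have "(\<lambda>X. X \<inter> incoming) ` circle P S ` incoming = orbit (state_walk S) ` incoming"
    using circle_incoming by (auto simp: image_image)
  ultimately show ?thesis by (metis card_image num_orbits_def)
qed

lemma arc_end_of_incoming:
  shows "inj_on arc_end_of incoming" "arc_end_of ` incoming = ends D"
proof -
  have other: "forward P (c, 1) \<longleftrightarrow> \<not> forward P (c, 0)" "forward P (c, 3) \<longleftrightarrow> \<not> forward P (c, 2)"
    if "c \<in> crossings P" for c using forward_ends[OF that] by auto
  show "inj_on arc_end_of incoming"
  proof (rule inj_onI)
    fix d e assume de: "d \<in> incoming" "e \<in> incoming" "arc_end_of d = arc_end_of e"
    obtain c i c' j where [simp]: "d = (c, i)" "e = (c', j)" by (cases d; cases e)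
    show "d = e" using de other
      by (cases i rule: four_cases; cases j rule: four_cases) (auto simp: incoming_def arc_end_of_def)
  qed
  show "arc_end_of ` incoming = ends D"
  proof
    show "arc_end_of ` incoming \<subseteq> ends D"
      by (auto simp: incoming_def arc_end_of_def all_A_dessin_simps)
    show "ends D \<subseteq> arc_end_of ` incoming"
    proof
      fix d assume "d \<in> ends D"
      then obtain c i where c: "c \<in> crossings P" "i = 0 \<or> i = 2" "d = (c, i)"
        by (auto simp: all_A_dessin_simps)
      define j where "j = (if forward P (c, i) then i + 1 else i)"
      have "(c, j) \<in> incoming" "arc_end_of (c, j) = d"
        using c other[OF c(1)] by (auto simp: j_def incoming_def arc_end_of_def)
      then show "d \<in> arc_end_of ` incoming" by (metis image_eqI)
    qed
  qed
qed

lemma A_circle_arc_end: "d \<in> darts P \<Longrightarrow> A_circle P (arc_end_of d) = A_circle P d"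
proof -
  assume d: "d \<in> darts P"
  obtain c i where [simp]: "d = (c, i)" by (cases d)
  have "arc_end_of d = d \<or> arc_end_of d = splice {} d"
    by (cases i rule: four_cases) (auto simp: arc_end_of_def splice_def)
  then show ?thesis using circle_splice[OF d] by metis
qed

text \<open>
  At a \<open>B\<close>-spliced crossing, the strand entered at \<open>d\<close> is left through the outgoing end of the other
  strand of the \<open>A\<close>-splicing, i.e. one passes over to the other end of the arc.
\<close>

lemma arc_end_of_state_walk:
  assumes d: "d \<in> incoming"
  shows "arc_end_of (state_walk S d) = (nxt D \<circ> opp_on D (arc_edges S)) (arc_end_of d)"
proof -
  obtain c i where ci: "d = (c, i)" by (cases d)
  have c: "c \<in> crossings P" and i: "\<not> forward P (c, i)" using d by (auto simp: incoming_def ci)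
  define m :: 4 where "m = (if i = 0 \<or> i = 1 then 0 else 2)"
  define k where "k = (if c \<in> S then m + 2 else m)"
  have k: "opp_on D (arc_edges S) (arc_end_of d) = (c, k)"
    by (simp add: k_def m_def ci opp_on_arc_edges arc_end_of_def)
  have "splice S d \<in> {(c, k), (c, k + 1)}"
    by (cases i rule: four_cases) (auto simp: ci k_def m_def splice_def)
  moreover have "forward P (splice S d)" using d by (simp add: incoming_def forward_splice)
  moreover have "forward P (c, k + 1) \<longleftrightarrow> \<not> forward P (c, k)" by (rule forward_succ[OF c])
  ultimately have "(THE e. e \<in> {(c, k), (c, k + 1)} \<and> forward P e) = splice S d"
    by (intro the_equality) auto
  then show ?thesis by (simp add: k all_A_dessin_simps state_walk_def)
qed

text \<open>
  The case of the all-\<open>A\<close> state: the arc-ends at an \<open>A\<close>-circle form a single cycle of \<open>nxt\<close>.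
\<close>

lemma is_dessin_all_A: "is_dessin D"
proof -
  have "cyclic_on (nxt D) {e \<in> ends D. vert D e = vert D x}" if "x \<in> ends D" for x
  proof -
    obtain d where d: "d \<in> incoming" "x = arc_end_of d"
      using \<open>x \<in> ends D\<close> arc_end_of_incoming(2) by blast
    have eq: "arc_end_of (state_walk {} e) = nxt D (arc_end_of e)" if "e \<in> incoming" for e
      using arc_end_of_state_walk[OF that, of "{}"] by (simp add: opp_on_def arc_edges_def)
    have vert: "vert D (arc_end_of e) = A_circle P e" if "e \<in> incoming" for e
      using that A_circle_arc_end by (simp add: incoming_def all_A_dessin_simps)
    have "{e \<in> ends D. vert D e = vert D x} = arc_end_of ` (A_circle P d \<inter> incoming)"
      unfolding arc_end_of_incoming(2)[symmetric] using d vert by (auto simp: mem_circle_iff)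
    also have "\<dots> = arc_end_of ` orbit (state_walk {}) d" using circle_incoming[OF d(1)] by simp
    also have "\<dots> = orbit (nxt D) x"
      unfolding d(2) using eq d(1)
      by (intro orbit_image[symmetric, OF bij_state_walk finite_incoming])
    finally show ?thesis
      using that by (intro cyclic_on_singleI[of x]) auto
  qed
  moreover have "finite (crossings P)" using dessin_M by (simp add: is_dessin_def)
  moreover have "A_circle P ` (crossings P \<times> {0, 2}) \<subseteq> A_circles P" by (auto simp: circles_eq)
  moreover have "opp D d \<in> ends D \<and> opp D d \<noteq> d \<and> opp D (opp D d) = d" if "d \<in> ends D" for d
    using that by (auto simp: all_A_dessin_simps)
  ultimately show ?thesis
    using finite_circles by (simp add: is_dessin_def all_A_dessin_simps(1-3))
qed

lemma card_circles_crossed: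
  assumes S: "S \<subseteq> crossings P"
  shows "card (circles P S) = num_faces (spanning_sub D (arc_edges S))"
proof -
  have F: "arc_edges S \<subseteq> edges D" using S by (auto simp: edges_all_A_dessin arc_edges_def)
  have "card (circles P S) =
      num_orbits (nxt D \<circ> opp_on D (arc_edges S)) (arc_end_of ` incoming)"
    unfolding card_circles
    by (rule num_orbits_image[symmetric, OF bij_state_walk finite_incoming arc_end_of_state_walk
          arc_end_of_incoming(1)])
  moreover have "verts D \<subseteq> vert D ` ends D"
  proof
    fix X assume "X \<in> verts D"
    then obtain d where d: "d \<in> darts P" "X = A_circle P d"
      by (auto simp: all_A_dessin_simps circles_eq)
    then have "X = A_circle P (arc_end_of d)" using A_circle_arc_end by simp
    moreover have "arc_end_of d \<in> ends D" using d
      by (cases d) (auto simp: arc_end_of_def all_A_dessin_simps)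
    ultimately show "X \<in> vert D ` ends D" by (simp add: all_A_dessin_simps)
  qed
  then have "card (verts D - vert D ` ends D) = 0" by (metis Diff_eq_empty_iff card.empty)
  ultimately show ?thesis
    by (simp add: num_faces_spanning_sub[OF is_dessin_all_A F] arc_end_of_incoming(2))
qed

end

lemma is_dessin_all_A_dessin:
  assumes "connected_projection P"
  shows "is_dessin (all_A_dessin P)"
proof (cases "crossings P = {}")
  case True
  then show ?thesis by (simp add: is_dessin_def all_A_dessin_def circles_def)
next
  case False
  then interpret crossed_projection P using assms by unfold_locales
  show ?thesis by (rule is_dessin_all_A)
qed

theorem card_circles_eq_num_faces:
  assumes "connected_projection P" "S \<subseteq> crossings P"
  shows "card (circles P S) = num_faces (spanning_sub (all_A_dessin P) (arc_edges S))"
proof (cases "crossings P = {}")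
  case True
  then show ?thesis
    using assms(2)
    by (simp add: arc_edges_def num_faces_spanning_sub_empty all_A_dessin_def circles_def)
next
  case False
  then interpret crossed_projection P using assms by unfold_locales
  show ?thesis by (rule card_circles_crossed[OF assms(2)])
qed


section \<open>The bracket at the value of \<open>A\<close> belonging to \<open>t = - 1\<close>\<close>

lemma laurent_eval_superset:
  assumes "finite K" "Poly_Mapping.keys p \<subseteq> K"
  shows "laurent_eval p z = (\<Sum>k\<in>K. of_int (Poly_Mapping.lookup p k) * z powi k)"
  unfolding laurent_eval_def
  by (rule sum.mono_neutral_left) (use assms in \<open>auto simp: in_keys_iff\<close>)

lemma laurent_eval_0 [simp]: "laurent_eval 0 z = 0"
  by (simp add: laurent_eval_def)

lemma laurent_eval_single [simp]: "laurent_eval (Poly_Mapping.single k a) z = of_int a * z powi k"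
  by (simp add: laurent_eval_def)

lemma laurent_eval_1 [simp]: "laurent_eval 1 z = 1"
  by (simp flip: single_one)

lemma laurent_eval_add [simp]: "laurent_eval (p + q) z = laurent_eval p z + laurent_eval q z"
proof -
  let ?K = "Poly_Mapping.keys p \<union> Poly_Mapping.keys q"
  show ?thesis
    using laurent_eval_superset[of ?K p z] laurent_eval_superset[of ?K q z]
      laurent_eval_superset[of ?K "p + q" z, OF _ keys_add]
    by (simp add: lookup_add sum.distrib distrib_right)
qed

lemma laurent_eval_uminus [simp]: "laurent_eval (- p) z = - laurent_eval p z"
  by (simp add: laurent_eval_def sum_negf)

lemma laurent_eval_diff [simp]: "laurent_eval (p - q) z = laurent_eval p z - laurent_eval q z"
  using laurent_eval_add[of p "- q" z] by simp

lemma laurent_eval_sum [simp]: "laurent_eval (\<Sum>x\<in>X. p x) z = (\<Sum>x\<in>X. laurent_eval (p x) z)"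
  by (induct X rule: infinite_finite_induct) simp_all

lemma laurent_poly_induct [case_names single add]:
  fixes p :: laurent_poly
  assumes "\<And>k a. Q (Poly_Mapping.single k a)" "\<And>p q. Q p \<Longrightarrow> Q q \<Longrightarrow> Q (p + q)"
  shows "Q p"
proof -
  have "Q (\<Sum>k\<in>K. Poly_Mapping.single k (f k))" if "finite K" for K :: "int set" and f :: "int \<Rightarrow> int"
    using that
  proof induct
    case empty
    show ?case using assms(1)[of 0 0] by simp
  qed (simp add: assms)
  moreover have "p = (\<Sum>k\<in>Poly_Mapping.keys p. Poly_Mapping.single k (Poly_Mapping.lookup p k))"
    by (rule poly_mapping_eqI) (simp add: lookup_sum lookup_single when_def in_keys_iff)
  ultimately show ?thesis by (metis finite_keys)
qed

lemma laurent_eval_mult [simp]: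
  assumes "z \<noteq> 0"
  shows "laurent_eval (p * q) z = laurent_eval p z * laurent_eval q z"
proof (induct p rule: laurent_poly_induct)
  case (single k a)
  show ?case
    by (induct q rule: laurent_poly_induct)
      (use assms in \<open>simp_all add: mult_single power_int_add algebra_simps\<close>)
qed (simp add: distrib_right)

lemma laurent_eval_power [simp]: "z \<noteq> 0 \<Longrightarrow> laurent_eval (p ^ n) z = laurent_eval p z ^ n"
  by (induct n) simp_all

lemma laurent_eval_prod [simp]:
  "z \<noteq> 0 \<Longrightarrow> laurent_eval (\<Prod>x\<in>X. p x) z = (\<Prod>x\<in>X. laurent_eval (p x) z)"
  by (induct X rule: infinite_finite_induct) simp_all

text \<open>
  At \<open>t = - 1\<close> the value \<open>- A\<^sup>2 - A\<^bsup>-2\<^esup>\<close> of a circle vanishes, so only the states with a single circle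
  contribute to the bracket, and each crossing that is spliced by \<open>B\<close> instead of \<open>A\<close> multiplies
  their weight by \<open>A\<^bsup>-2\<^esup> = \<i>\<close>. The factor coming from the writhe has absolute value one.
\<close>

lemma link_determinant_eq_one_circle_sum:
  assumes fin: "finite (crossings P)"
    and pos: "\<And>S. S \<subseteq> crossings P \<Longrightarrow> card (circles P S) \<noteq> 0"
  shows "link_determinant P U =
    cmod (\<Sum>S | S \<subseteq> crossings P \<and> card (circles P S) = 1. \<i> ^ card S)"
proof -
  define A :: complex where "A = (- 1) powr (- 1 / 4)"
  define n where "n = card (crossings P)"
  have A: "A = cis (- pi / 4)"
    by (simp add: A_def powr_def cis_conv_exp algebra_simps)
  have nz: "A \<noteq> 0" and norm: "cmod A = 1" by (simp_all add: A)
  have A2: "A powi 2 = - \<i>" "A powi (- 2) = \<i>"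
  proof -
    have "A ^ 2 = cis (- pi / 4 + - pi / 4)" by (simp only: A power2_eq_square cis_mult)
    also have "- pi / 4 + - pi / 4 = - (pi / 2)" by simp
    finally have "A ^ 2 = - \<i>" by (simp add: complex_eq_iff)
    then show "A powi 2 = - \<i>" by simp
    then show "A powi (- 2) = \<i>" by (simp add: power_int_minus)
  qed
  have summand: "laurent_eval (Poly_Mapping.single (int (card (crossings P - S)) - int (card S)) 1 *
        (- Poly_Mapping.single 2 1 - Poly_Mapping.single (- 2) 1) ^ (card (circles P S) - 1)) A =
      (if card (circles P S) = 1 then A powi int n * \<i> ^ card S else 0)"
    if S: "S \<subseteq> crossings P" for S
  proof -
    have "finite S" using S fin by (rule finite_subset)
    then have "int (card (crossings P - S)) = int n - int (card S)"
      using S fin by (simp add: n_def card_Diff_subset card_mono of_nat_diff)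
    then have "int (card (crossings P - S)) - int (card S) = int n + (- 2) * int (card S)" by simp
    then have "A powi (int (card (crossings P - S)) - int (card S)) =
        A powi (int n + (- 2) * int (card S))" by (rule arg_cong)
    also have "\<dots> = A powi int n * (A powi (- 2)) powi int (card S)"
      using nz by (subst power_int_add) (auto simp only: power_int_mult)
    also have "\<dots> = A powi int n * \<i> ^ card S"
      by (simp only: A2(2) power_int_of_nat)
    finally show ?thesis
      using nz A2 pos[OF S] by (auto simp: power_0_left)
  qed
  have "laurent_eval (kauffman_bracket P) A =
      (\<Sum>S\<in>Pow (crossings P). if card (circles P S) = 1 then A powi int n * \<i> ^ card S else 0)"
    unfolding kauffman_bracket_def laurent_eval_sum by (rule sum.cong) (use summand in auto)
  also have "\<dots> = (\<Sum>S | S \<subseteq> crossings P \<and> card (circles P S) = 1. A powi int n * \<i> ^ card S)"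
    using fin by (subst sum.inter_filter[symmetric]) (auto intro: sum.cong)
  finally have bracket: "laurent_eval (kauffman_bracket P) A =
      A powi int n * (\<Sum>S | S \<subseteq> crossings P \<and> card (circles P S) = 1. \<i> ^ card S)"
    by (simp add: sum_distrib_left)
  have unit: "cmod (A powi k) = 1" for k by (simp add: norm_power_int norm)
  have "cmod (\<Prod>c\<in>crossings P. laurent_eval (if positive_crossing U c
        then Poly_Mapping.single (- 3) (- 1) else Poly_Mapping.single 3 (- 1)) A) = 1"
    unfolding prod_norm[symmetric]
    by (rule prod.neutral) (auto simp: unit simp del: power_int_minus power_int_numeral)
  moreover have "link_determinant P U = cmod (laurent_eval (jones_poly P U) A)"
    unfolding link_determinant_def jones_def A_def ..
  ultimately show ?thesis
    unfolding jones_poly_def laurent_eval_mult[OF nz] laurent_eval_prod[OF nz] bracket norm_mult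
      unit by simp
qed

lemma one_circle_sum_eq_one_face_sum:
  assumes "connected_projection P"
  shows "(\<Sum>S | S \<subseteq> crossings P \<and> card (circles P S) = 1. \<i> ^ card S) =
    (\<Sum>F | F \<subseteq> edges (all_A_dessin P) \<and> num_faces (spanning_sub (all_A_dessin P) F) = 1. \<i> ^ card F)"
proof (rule sum.reindex_bij_betw[where h = arc_edges, symmetric, THEN trans, THEN sym])
  show "bij_betw arc_edges {S. S \<subseteq> crossings P \<and> card (circles P S) = 1}
      {F. F \<subseteq> edges (all_A_dessin P) \<and> num_faces (spanning_sub (all_A_dessin P) F) = 1}"
  proof (rule bij_betw_imageI)
    show "inj_on arc_edges {S. S \<subseteq> crossings P \<and> card (circles P S) = 1}"
      unfolding arc_edges_def
      by (rule inj_on_subset[OF inj_on_image_Pow[OF inj_arc_edge[of UNIV]]]) auto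
    show "arc_edges ` {S. S \<subseteq> crossings P \<and> card (circles P S) = 1} =
      {F. F \<subseteq> edges (all_A_dessin P) \<and> num_faces (spanning_sub (all_A_dessin P) F) = 1}"
    proof
      show "{F. F \<subseteq> edges (all_A_dessin P) \<and> num_faces (spanning_sub (all_A_dessin P) F) = 1} \<subseteq>
          arc_edges ` {S. S \<subseteq> crossings P \<and> card (circles P S) = 1}"
      proof clarify
        fix F assume F: "F \<subseteq> edges (all_A_dessin P)" "num_faces (spanning_sub (all_A_dessin P) F) = 1"
        then obtain S where "S \<subseteq> crossings P" "F = arc_edges S"
          unfolding edges_all_A_dessin arc_edges_def by (auto simp: subset_image_iff)
        then show "F \<in> arc_edges ` {S. S \<subseteq> crossings P \<and> card (circles P S) = 1}"
          using F(2) card_circles_eq_num_faces[OF assms] by auto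
      qed
      show "arc_edges ` {S. S \<subseteq> crossings P \<and> card (circles P S) = 1} \<subseteq>
          {F. F \<subseteq> edges (all_A_dessin P) \<and> num_faces (spanning_sub (all_A_dessin P) F) = 1}"
        using card_circles_eq_num_faces[OF assms]
        by (auto simp: edges_all_A_dessin arc_edges_def)
    qed
  qed
qed (auto simp: arc_edges_def card_image inj_arc_edge)

theorem theorem3p2:
  fixes P :: "'c projection" and U :: "'c dart set"
  assumes "connected_projection P"
    and "orientation P U"
  shows "link_determinant P U =
    \<bar>\<Sum>j = 0..nat \<lfloor>genus (all_A_dessin P)\<rfloor>. (-1) ^ j * real (num_quasi_trees j (all_A_dessin P))\<bar>"
proof -
  have fin: "finite (crossings P)"
    using assms(1) by (simp add: connected_projection_def is_dessin_def plane_map_def)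
  have "card (circles P S) \<noteq> 0" for S
    using fin by (simp add: circles_def darts_def)
  with fin have "link_determinant P U =
      cmod (\<Sum>S | S \<subseteq> crossings P \<and> card (circles P S) = 1. \<i> ^ card S)"
    by (rule link_determinant_eq_one_circle_sum)
  also have "\<dots> = cmod (\<i> ^ (card (verts (all_A_dessin P)) - 1) * complex_of_real
      (\<Sum>j = 0..nat \<lfloor>genus (all_A_dessin P)\<rfloor>. (-1) ^ j * real (num_quasi_trees j (all_A_dessin P))))"
    unfolding one_circle_sum_eq_one_face_sum[OF assms(1)]
      one_face_sum_eq_quasi_tree_sum[OF is_dessin_all_A_dessin[OF assms(1)]] ..
  finally show ?thesis by (simp only: norm_mult norm_power norm_ii power_one mult_1 norm_of_real)
qed

end
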